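(* Suppose Assumption A holds and Assumption B holds for some $p\ge2$. Define \[ M_p=4\Big(f(x^0)-f_{\mathrm{low}}+p\sigma^2+\frac{3L_1}{2}+\frac{7L_p^2}{(p!)^2}+2\big(p+1+32p^{2p}L_p^2+16(p!)^2\sigma^2\big)\Big). \] Let $\{x^k\}_{k\ge0}$ be generated by Algorithm 1 with $q=p-1$ and, for all $1\le t\le p-1$, $k\ge0$, \[ \eta_k=\frac{1}{(k+p)^{(2p+1)/(3p+1)}},\qquad \gamma_{k,t}=\frac{1}{t(k+p)^{2p/(3p+1)}}, \] \[ \theta_{k,t}=\frac{\prod_{1\le s\le p-1,\,s\neq t}\big(1-s(k+p)^{2p/(3p+1)}\big)}{t(k+p)^{2p/(3p+1)}\prod_{1\le s\le p-1,\,s\neq t}\big((t-s)(k+p)^{2p/(3p+1)}\big)}. \] For $K\ge1$ let $\iota_K$ be drawn uniformly from $\{0,\dots,K-1\}$, independently of the algorithm. Then for every $\epsilon\in(0,1)$, \[ \mathbb{E}[\|\nabla f(x^{\iota_K})\|]\le\epsilon\qquad\text{for all } K\ge\max\Big\{\Big(\frac{(6p+2)M_p}{p\epsilon}\ln\Big(\frac{(6p+2)M_p}{p\epsilon}\Big)\Big)^{(3p+1)/p},\,2p\Big\}, \] where the expectation is over the randomness of the algorithm and of $\iota_K$.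
   Context: Problem: minimize $f:\mathbb{R}^n\to\mathbb{R}$, where only a stochastic gradient estimator $G(\cdot;\xi)$ is accessible, $\xi$ being a random variable with sample space $\Xi$. $\|\cdot\|$ is the Euclidean norm. An empty product equals $1$. Assumption A: (a) there is a finite $f_{\mathrm{low}}$ with $f(x)\ge f_{\mathrm{low}}$ for all $x$; (b) there is $L_1>0$ with $\|\nabla f(y)-\nabla f(x)\|\le L_1\|y-x\|$ for all $x,y$; (c) $\mathbb{E}_\xi[G(x;\xi)]=\nabla f(x)$ and $\mathbb{E}_\xi[\|G(x;\xi)-\nabla f(x)\|^2]\le\sigma^2$ for all $x$, for some $\sigma>0$. Assumption B: $f$ is $p$ times continuously differentiable for some $p\ge2$ and there is $L_p>0$ with $\|D^pf(y)-D^pf(x)\|_{(p)}\le L_p\|y-x\|$ for all $x,y$, where $D^pf(x)$ is the $p$th derivative as a symmetric $p$-linear form and $\|\mathcal{T}\|_{(p)}=\max\{\mathcal{T}[h_1,\dots,h_p]:\|h_i\|\le 1\}$. Algorithm 1 (SFOM with multi-extrapolated momentum): inputs $x^0\in\mathbb{R}^n$, step sizes $\eta_k>0$, an integer $q\ge1$, extrapolation parameters $\gamma_{k,t}\in(0,1)$ and weighting parameters $\theta_{k,t}\in\mathbb{R}$ ($1\le t\le q$, $k\ge0$) with $\sum_{t=1}^q\theta_{k,t}\in(0,1)$ for all $k\ge0$. Initialize $x^{-1}=x^0$, $m^{-1}=0$, $(\gamma_{-1,t},\theta_{-1,t})=(1,1/q)$ for all $t$. For $k=0,1,2,\dots$: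 $z^{k,t}=x^k+\frac{1-\gamma_{k-1,t}}{\gamma_{k-1,t}}(x^k-x^{k-1})$ for $1\le t\le q$; $m^k=(1-\sum_{t=1}^q\theta_{k-1,t})m^{k-1}+\sum_{t=1}^q\theta_{k-1,t}G(z^{k,t};\xi^k)$; $x^{k+1}=x^k-\eta_k m^k/\|m^k\|$. Here $\xi^0,\xi^1,\dots$ are independent samples of $\xi$ (and $m^k\neq0$ is implicitly assumed). *)

theory Defs
  imports "HOL-Probability.Probability"
begin

text \<open>State after k iterations: (x^k, x^(k-1), m^(k-1)).  Parameters:
  G (stochastic gradient), x0, step sizes eta, q, extrapolation gam k t (= gamma_{k,t}),
  weights th k t (= theta_{k,t}), and the sample sequence xi (xi k = xi^k).
  The initialisation (gamma_{-1,t}, theta_{-1,t}) = (1, 1/q) is used at k = 0.\<close>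

primrec sfom_state ::
  "('a::real_normed_vector \<Rightarrow> 'b \<Rightarrow> 'a) \<Rightarrow> 'a \<Rightarrow> (nat \<Rightarrow> real) \<Rightarrow> nat \<Rightarrow>
   (nat \<Rightarrow> nat \<Rightarrow> real) \<Rightarrow> (nat \<Rightarrow> nat \<Rightarrow> real) \<Rightarrow> (nat \<Rightarrow> 'b) \<Rightarrow> nat \<Rightarrow> 'a \<times> 'a \<times> 'a"
where
  "sfom_state G x0 eta q gam th xi 0 = (x0, x0, 0)"
| "sfom_state G x0 eta q gam th xi (Suc k) =
     (let (x, xp, m) = sfom_state G x0 eta q gam th xi k;
          g = (if k = 0 then (\<lambda>t. 1) else gam (k - 1));
          w = (if k = 0 then (\<lambda>t. 1 / real q) else th (k - 1));
          z = (\<lambda>t. x + ((1 - g t) / g t) *\<^sub>R (x - xp));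
          m' = (1 - (\<Sum>t\<in>{1..q}. w t)) *\<^sub>R m + (\<Sum>t\<in>{1..q}. w t *\<^sub>R G (z t) (xi k))
      in (x - (eta k / norm m') *\<^sub>R m', x, m'))"

definition sfom_x where
  "sfom_x G x0 eta q gam th xi k = fst (sfom_state G x0 eta q gam th xi k)"

definition sfom_m where
  "sfom_m G x0 eta q gam th xi k = snd (snd (sfom_state G x0 eta q gam th xi (Suc k)))"

definition eta_p :: "nat \<Rightarrow> nat \<Rightarrow> real" where
  "eta_p p k = 1 / (real k + real p) powr ((2 * real p + 1) / (3 * real p + 1))"

definition gamma_p :: "nat \<Rightarrow> nat \<Rightarrow> nat \<Rightarrow> real" where
  "gamma_p p k t = 1 / (real t * (real k + real p) powr (2 * real p / (3 * real p + 1)))"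

definition theta_p :: "nat \<Rightarrow> nat \<Rightarrow> nat \<Rightarrow> real" where
  "theta_p p k t =
     (let a = (real k + real p) powr (2 * real p / (3 * real p + 1)) in
      (\<Prod>s\<in>{1..p-1} - {t}. 1 - real s * a) /
      (real t * a * (\<Prod>s\<in>{1..p-1} - {t}. (real t - real s) * a)))"

text \<open>D j x [h1,...,hj] represents the j-th derivative D^j f(x)[h1,...,hj].
  has_derivs_upto p f D: D 0 = f, each D (j+1) is the (Frechet) derivative of D j
  (for j < p), and D p is continuous, i.e. f is p times continuously differentiable
  with derivatives D.\<close>

definition has_derivs_upto ::
  "nat \<Rightarrow> ('a::euclidean_space \<Rightarrow> real) \<Rightarrow> (nat \<Rightarrow> 'a \<Rightarrow> 'a list \<Rightarrow> real) \<Rightarrow> bool" where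
  "has_derivs_upto p f D \<longleftrightarrow>
     (\<forall>x. D 0 x [] = f x) \<and>
     (\<forall>j<p. \<forall>x hs. length hs = j \<longrightarrow>
        ((\<lambda>y. D j y hs) has_derivative (\<lambda>h. D (Suc j) x (h # hs))) (at x)) \<and>
     (\<forall>hs. length hs = p \<longrightarrow> continuous_on UNIV (\<lambda>x. D p x hs))"

definition multilin_norm :: "nat \<Rightarrow> ('a::real_normed_vector list \<Rightarrow> real) \<Rightarrow> real" where
  "multilin_norm p T = Sup {T hs | hs. length hs = p \<and> (\<forall>h\<in>set hs. norm h \<le> 1)}"

definition M_const :: "nat \<Rightarrow> real \<Rightarrow> real \<Rightarrow> real \<Rightarrow> real \<Rightarrow> real \<Rightarrow> real" where
  "M_const p fx0 flow sig L1 Lp =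
     4 * (fx0 - flow + real p * sig\<^sup>2 + 3 * L1 / 2 + 7 * Lp\<^sup>2 / (fact p)\<^sup>2
          + 2 * (real p + 1 + 32 * real p ^ (2 * p) * Lp\<^sup>2 + 16 * (fact p)\<^sup>2 * sig\<^sup>2))"

end

theory Submission
  imports Defs "HOL-Computational_Algebra.Polynomial"
begin

text \<open>
  The weights \<open>\<theta>\<^sub>k\<^sub>,\<^sub>t\<close> are Lagrange interpolation weights: with the nodes \<open>u\<^sub>t = 1 / \<gamma>\<^sub>k\<^sub>,\<^sub>t\<close> one has
  \<open>\<Sum>\<^sub>t \<theta>\<^sub>k\<^sub>,\<^sub>t u\<^sub>t\<^sup>r = 1\<close> for \<open>1 \<le> r < p\<close>.  Since the extrapolated points are \<open>x\<^sup>k + u\<^sub>t (x\<^sup>k\<^sup>+\<^sup>1 - x\<^sup>k)\<close>, all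
  Taylor terms of the gradient below order \<open>p\<close> cancel in the recursion of the momentum error
  \<open>e\<^sup>k = m\<^sup>k - \<nabla>f(x\<^sup>k)\<close>, which therefore reads
  \<open>e\<^sup>k\<^sup>+\<^sup>1 = (1 - \<theta>) e\<^sup>k + O(\<eta>\<^sup>p / \<gamma>\<^sup>p\<^sup>-\<^sup>1) + (mean-zero noise of size \<gamma>)\<close> with \<open>\<theta> \<ge> \<gamma>\<close>.
  The weight \<open>(k + p) powr ((p - 1) / (3p + 1))\<close> on \<open>E\<bar>e\<^sup>k\<bar>\<^sup>2\<close> grows slowly enough to be absorbed by the
  contraction, and for the prescribed schedules it turns bias, noise and the Young remainder of the
  descent inequality into multiples of \<open>1 / (k + p)\<close>.  Hence \<open>\<Sum>\<^sub>k \<eta>\<^sub>k E\<bar>\<nabla>f(x\<^sup>k)\<bar> = O(ln K)\<close>, and dividing by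
  \<open>K \<eta>\<^sub>K\<close> gives the rate \<open>ln K / K powr (p / (3p + 1))\<close>.
\<close>

section \<open>Lagrange weights\<close>

text \<open>The interpolant of \<open>x ^ r\<close> and the monomial itself have degree below
  \<open>card S\<close> and agree at the \<open>card S\<close> distinct nodes, so they are the same
  polynomial.\<close>

lemma lagrange_monomial:
  fixes u :: "'i \<Rightarrow> real"
  assumes fin: "finite S" and inj: "inj_on u S" and r: "r < card S"
  shows "(\<Sum>t\<in>S. (\<Prod>s\<in>S-{t}. (x - u s) / (u t - u s)) * u t ^ r) = x ^ r"
proof -
  define Q where "Q = (\<Sum>t\<in>S. smult (u t ^ r) (\<Prod>s\<in>S-{t}. [:- u s / (u t - u s), 1 / (u t - u s):]))"
  have ev: "poly Q y = (\<Sum>t\<in>S. (\<Prod>s\<in>S-{t}. (y - u s) / (u t - u s)) * u t ^ r)" for y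
    by (auto simp: Q_def poly_sum poly_prod mult.commute diff_divide_distrib intro!: sum.cong prod.cong)
  have "degree Q < card S"
    unfolding Q_def
  proof (intro degree_sum_less)
    show "0 < card S" using r by simp
    fix t assume t: "t \<in> S"
    have "degree (smult (u t ^ r) (\<Prod>s\<in>S-{t}. [:- u s / (u t - u s), 1 / (u t - u s):]))
        \<le> (\<Sum>s\<in>S-{t}. degree [:- u s / (u t - u s), 1 / (u t - u s):])"
      by (rule order_trans[OF degree_smult_le degree_prod_sum_le[unfolded o_def]]) (use fin in auto)
    also have "\<dots> \<le> (\<Sum>s\<in>S-{t}. 1)" by (intro sum_mono) auto
    also have "\<dots> < card S" using t fin r by (simp add: card_Diff_singleton)
    finally show "degree (smult (u t ^ r) (\<Prod>s\<in>S-{t}. [:- u s / (u t - u s), 1 / (u t - u s):])) < card S" .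
  qed
  moreover have "poly Q y = poly (monom 1 r) y" if y: "y \<in> u ` S" for y
  proof -
    obtain j where j: "j \<in> S" "y = u j" using y by auto
    have "poly Q y = (\<Sum>t\<in>S. if t = j then u j ^ r else 0)"
      unfolding ev
    proof (rule sum.cong)
      fix t assume t: "t \<in> S"
      show "(\<Prod>s\<in>S-{t}. (y - u s) / (u t - u s)) * u t ^ r = (if t = j then u j ^ r else 0)"
      proof (cases "t = j")
        case True
        have "(\<Prod>s\<in>S-{t}. (y - u s) / (u t - u s)) = 1"
          using True j inj by (intro prod.neutral) (auto simp: inj_on_def)
        then show ?thesis using True by simp
      next
        case False
        then have "(\<Prod>s\<in>S-{t}. (y - u s) / (u t - u s)) = 0"
          using j fin by (intro prod_zero bexI[of _ j]) auto
        then show ?thesis using False by simp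
      qed
    qed simp
    then show ?thesis using j fin by (simp add: poly_monom)
  qed
  ultimately have "Q = monom 1 r"
    using r by (intro poly_eqI_degree[of "u ` S"]) (auto simp: card_image[OF inj] degree_monom_eq)
  then show ?thesis using ev[of x] by (simp add: poly_monom)
qed

text \<open>The extra node \<open>0\<close> makes the moment identity hold for \<open>r = 0\<close> as well, which yields \<open>\<Sum>\<^sub>t \<theta>\<^sub>t\<close>;
  for \<open>r \<ge> 1\<close> it contributes nothing.\<close>
definition lagrange_weight :: "nat \<Rightarrow> real \<Rightarrow> nat \<Rightarrow> real" where
  "lagrange_weight q a t = (\<Prod>s\<in>{0..q}-{t}. (1 - real s * a) / ((real t - real s) * a))"

text \<open>The common spacing \<open>a\<close> of the nodes: \<open>t * a\<close> is the reciprocal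
  of \<open>gamma_p p k t\<close>.\<close>

definition theta_node :: "nat \<Rightarrow> nat \<Rightarrow> real" where
  "theta_node p k = (real k + real p) powr (2 * real p / (3 * real p + 1))"

text \<open>The factor of the extra node \<open>s = 0\<close> is \<open>1 / (t * a)\<close>,
  precisely the prefactor in \<open>theta_p\<close>.\<close>

lemma theta_p_eq_lagrange_weight:
  assumes "t \<in> {1..p-1}"
  shows "theta_p p k t = lagrange_weight (p-1) (theta_node p k) t"
proof -
  have "{0..p-1} - {t} = insert 0 ({1..p-1} - {t})" using assms by auto
  then show ?thesis
    by (simp add: theta_p_def lagrange_weight_def theta_node_def Let_def prod_dividef)
qed

lemma lagrange_weight_moment:
  assumes a: "a > 0" and r: "r \<le> q"
  shows "(\<Sum>t\<in>{0..q}. lagrange_weight q a t * (real t * a) ^ r) = 1"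
proof -
  have "(\<Sum>t\<in>{0..q}. (\<Prod>s\<in>{0..q}-{t}. (1 - real s * a) / (real t * a - real s * a)) * (real t * a) ^ r) = 1 ^ r"
    using a r by (intro lagrange_monomial) (auto simp: inj_on_def)
  then show ?thesis by (simp add: lagrange_weight_def left_diff_distrib)
qed

lemma sum_lagrange_weight_power:
  assumes "a > 0" "r \<le> q" "r \<ge> 1"
  shows "(\<Sum>t\<in>{1..q}. lagrange_weight q a t * (real t * a) ^ r) = 1"
proof -
  have "{0..q} = insert 0 {1..q}" by auto
  then show ?thesis using lagrange_weight_moment[OF assms(1,2)] assms(3) by (simp add: zero_power)
qed

text \<open>The moment of order 0 over all nodes is 1, so the sum is 1 minus the weight of node 0,
  whose factors \<open>(1 - s * a) / (- s * a)\<close> are \<open>1 - 1 / (s * a)\<close>.\<close>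

lemma sum_lagrange_weight:
  assumes "a > 0"
  shows "(\<Sum>t\<in>{1..q}. lagrange_weight q a t) = 1 - (\<Prod>s\<in>{1..q}. 1 - 1 / (real s * a))"
proof -
  have *: "{0..q} = insert 0 {1..q}" "{0..q} - {0} = {1..q}" by auto
  have "lagrange_weight q a 0 = (\<Prod>s\<in>{1..q}. 1 - 1 / (real s * a))"
    using assms by (auto simp: lagrange_weight_def *(2) field_simps intro!: prod.cong)
  then show ?thesis using lagrange_weight_moment[OF assms, of 0 q] by (simp add: *(1))
qed

text \<open>Every factor of the product lies in [0, 1], and the factor \<open>s = 1\<close> alone
  already brings it down to \<open>1 - 1 / a\<close>.\<close>

lemma sum_lagrange_weight_bounds:
  assumes a: "a \<ge> 1" and q: "q \<ge> 1"
  shows "1 / a \<le> (\<Sum>t\<in>{1..q}. lagrange_weight q a t)" "(\<Sum>t\<in>{1..q}. lagrange_weight q a t) \<le> 1"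
proof -
  have f: "0 \<le> 1 - 1 / (real s * a) \<and> 1 - 1 / (real s * a) \<le> 1" if "s \<ge> 1" for s
    using that a mult_mono[of 1 "real s" 1 a] by (simp add: field_simps)
  have "(\<Prod>s\<in>{1..q}. 1 - 1 / (real s * a)) = (1 - 1 / a) * (\<Prod>s\<in>{1..q}-{1}. 1 - 1 / (real s * a))"
    using q by (subst prod.remove[of _ 1]) auto
  also have "\<dots> \<le> (1 - 1 / a) * 1"
    using f f[of 1] by (intro mult_left_mono prod_le_1) auto
  finally show "1 / a \<le> (\<Sum>t\<in>{1..q}. lagrange_weight q a t)"
    using a by (subst sum_lagrange_weight) auto
  have "0 \<le> (\<Prod>s\<in>{1..q}. 1 - 1 / (real s * a))" using f by (intro prod_nonneg) auto
  then show "(\<Sum>t\<in>{1..q}. lagrange_weight q a t) \<le> 1"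
    using a by (subst sum_lagrange_weight) auto
qed

text \<open>Node 0 contributes \<open>1 / (t * a)\<close>. Every other factor is at most
  \<open>s\<close>, because \<open>s * a \<ge> 1\<close> bounds the numerator by
  \<open>s * a\<close> and distinct integers are at least 1 apart.\<close>

lemma abs_lagrange_weight_le:
  assumes a: "a \<ge> 1" and t: "t \<in> {1..q}"
  shows "\<bar>lagrange_weight q a t\<bar> \<le> fact q / (real t * a)"
proof -
  have *: "{0..q} - {t} = insert 0 ({1..q} - {t})" using t by auto
  have "\<bar>(1 - real s * a) / ((real t - real s) * a)\<bar> \<le> real s" if s: "s \<in> {1..q} - {t}" for s
  proof -
    have "s \<noteq> t" using s by auto
    then have "\<bar>int t - int s\<bar> \<ge> 1" by auto
    then have "1 \<le> \<bar>real t - real s\<bar>" using s by linarith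
    moreover have "1 \<le> real s * a" using s a mult_mono[of 1 "real s" 1 a] by simp
    ultimately have "\<bar>1 - real s * a\<bar> \<le> real s * (\<bar>real t - real s\<bar> * a)"
      using mult_left_mono[of 1 "\<bar>real t - real s\<bar>" "real s * a"] by (simp add: ac_simps)
    then show ?thesis using \<open>1 \<le> \<bar>real t - real s\<bar>\<close> a
      by (simp add: abs_mult divide_le_eq)
  qed
  then have "(\<Prod>s\<in>{1..q} - {t}. \<bar>(1 - real s * a) / ((real t - real s) * a)\<bar>) \<le> (\<Prod>s\<in>{1..q} - {t}. real s)"
    by (intro prod_mono) auto
  \<comment> \<open>The skipped factor \<open>t \<ge> 1\<close> is restored to complete the
    factorial.\<close>
  also have "\<dots> \<le> (\<Prod>s\<in>{1..q} - {t}. real s) * real t"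
    using t mult_left_mono[of 1 "real t" "\<Prod>s\<in>{1..q} - {t}. real s"] by (auto simp: prod_nonneg)
  also have "\<dots> = (\<Prod>s\<in>{1..q}. real s)" using t by (subst prod.remove[of "{1..q}" t]) (auto simp: mult.commute)
  also have "\<dots> = fact q" by (simp add: fact_prod)
  finally have "(\<Prod>s\<in>{1..q} - {t}. \<bar>(1 - real s * a) / ((real t - real s) * a)\<bar>) \<le> fact q" .
  then have "\<bar>1 / (real t * a)\<bar> * (\<Prod>s\<in>{1..q} - {t}. \<bar>(1 - real s * a) / ((real t - real s) * a)\<bar>) \<le> 1 / (real t * a) * fact q"
    using a by (intro mult_mono prod_nonneg) auto
  then show ?thesis unfolding lagrange_weight_def * by (subst prod.insert) (simp_all only: abs_mult abs_prod, simp_all)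
qed

section \<open>Taylor expansion of the gradient\<close>

primrec multilinear_form :: "nat \<Rightarrow> ('a::real_vector list \<Rightarrow> real) \<Rightarrow> bool" where
  "multilinear_form 0 T = True"
| "multilinear_form (Suc n) T =
    ((\<forall>hs. length hs = n \<longrightarrow> linear (\<lambda>h. T (h # hs))) \<and> (\<forall>h. multilinear_form n (\<lambda>hs. T (h # hs))))"

text \<open>Expanding the head argument in \<open>Basis\<close>, with coefficients of modulus at
  most 1, reduces the claim to the finitely many forms with a basis vector at the head. The bound is
  two-sided because the coefficients may be negative.\<close>

lemma multilinear_form_bounded:
  fixes T :: "'a::euclidean_space list \<Rightarrow> real"
  assumes "multilinear_form n T"
  shows "\<exists>C. \<forall>hs. length hs = n \<and> (\<forall>h\<in>set hs. norm h \<le> 1) \<longrightarrow> T hs \<le> C \<and> - T hs \<le> C"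
  using assms
proof (induction n arbitrary: T)
  case 0
  show ?case by (intro exI[of _ "\<bar>T []\<bar>"]) auto
next
  case (Suc n)
  then have "\<forall>b. \<exists>C. \<forall>hs. length hs = n \<and> (\<forall>h\<in>set hs. norm h \<le> 1) \<longrightarrow> T (b # hs) \<le> C \<and> - T (b # hs) \<le> C"
    by simp
  then obtain C where C: "\<And>b hs. length hs = n \<Longrightarrow> (\<forall>h\<in>set hs. norm h \<le> 1) \<Longrightarrow> T (b # hs) \<le> C b \<and> - T (b # hs) \<le> C b"
    by metis
  show ?case
  proof (intro exI[of _ "\<Sum>b\<in>Basis. C b"] allI impI, elim conjE)
    fix hs :: "'a list" assume hs: "length hs = Suc n" "\<forall>h\<in>set hs. norm h \<le> 1"
    obtain h gs where hg: "hs = h # gs" "length gs = n" using hs(1) by (cases hs) auto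
    have lin: "linear (\<lambda>h. T (h # gs))" using Suc.prems hg by simp
    have "\<bar>T hs\<bar> = \<bar>T ((\<Sum>b\<in>Basis. (h \<bullet> b) *\<^sub>R b) # gs)\<bar>" by (simp add: hg euclidean_representation)
    also have "\<dots> = \<bar>\<Sum>b\<in>Basis. (h \<bullet> b) * T (b # gs)\<bar>"
      by (simp add: linear_sum[OF lin] linear_scale[OF lin])
    also have "\<dots> \<le> (\<Sum>b\<in>Basis. \<bar>h \<bullet> b\<bar> * \<bar>T (b # gs)\<bar>)"
      by (rule order_trans[OF sum_abs]) (simp add: abs_mult)
    also have "\<dots> \<le> (\<Sum>b\<in>Basis. 1 * C b)"
    proof (intro sum_mono mult_mono)
      fix b :: 'a assume b: "b \<in> Basis"
      show "\<bar>h \<bullet> b\<bar> \<le> 1" using Basis_le_norm[OF b, of h] hs(2) hg by auto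
      show "\<bar>T (b # gs)\<bar> \<le> C b" using C[of gs b] hs hg by auto
    qed auto
    finally show "T hs \<le> (\<Sum>b\<in>Basis. C b) \<and> - T hs \<le> (\<Sum>b\<in>Basis. C b)" by (simp add: abs_le_iff)
  qed
qed

lemma multilinear_form_diff:
  "multilinear_form n S \<Longrightarrow> multilinear_form n T \<Longrightarrow> multilinear_form n (\<lambda>hs. S hs - T hs)"
proof (induction n arbitrary: S T)
  case (Suc n)
  then show ?case by (auto intro: linear_compose_sub)
qed simp

text \<open>Additivity and homogeneity in a slot hold at every base point \<open>y\<close>, and
  uniqueness of the derivative carries them over to \<open>F'\<close>.\<close>

lemma multilinear_form_derivative:
  fixes F :: "'a::real_normed_vector \<Rightarrow> 'b::real_vector list \<Rightarrow> real"
  assumes "\<And>y. multilinear_form n (F y)"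
    and "\<And>hs. length hs = n \<Longrightarrow> ((\<lambda>y. F y hs) has_derivative F' hs) (at x)"
  shows "multilinear_form n (\<lambda>hs. F' hs h)"
  using assms
proof (induction n arbitrary: F F')
  case (Suc n)
  have "multilinear_form n (\<lambda>hs. F' (k # hs) h)" for k
    by (rule Suc.IH[of "\<lambda>y hs. F y (k # hs)" "\<lambda>hs. F' (k # hs)"]) (use Suc.prems in simp_all)
  moreover have "linear (\<lambda>k. F' (k # hs) h)" if hs: "length hs = n" for hs
  proof (rule linearI)
    have D: "((\<lambda>y. F y (k # hs)) has_derivative F' (k # hs)) (at x)" for k
      using Suc.prems(2) hs by simp
    have lin: "linear (\<lambda>k. F y (k # hs))" for y using Suc.prems(1)[of y] hs by simp
    fix a b and r :: real
    have "((\<lambda>y. F y ((a + b) # hs)) has_derivative (\<lambda>h. F' (a # hs) h + F' (b # hs) h)) (at x)"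
      using has_derivative_add[OF D[of a] D[of b]] by (simp add: linear_add[OF lin])
    from fun_cong[OF has_derivative_unique[OF D this], of h]
    show "F' ((a + b) # hs) h = F' (a # hs) h + F' (b # hs) h" .
    have "((\<lambda>y. F y ((r *\<^sub>R a) # hs)) has_derivative (\<lambda>h. r * F' (a # hs) h)) (at x)"
      using has_derivative_mult_right[OF D[of a], of r] by (simp add: linear_scale[OF lin])
    from fun_cong[OF has_derivative_unique[OF D this], of h]
    show "F' ((r *\<^sub>R a) # hs) h = r *\<^sub>R F' (a # hs) h" by simp
  qed
  ultimately show ?case by simp
qed simp

text \<open>Being a Frechet derivative gives linearity only in the newest (head) slot; the older
  slots inherit it from the form being differentiated.\<close>

lemma has_derivs_upto_multilinear:
  assumes "has_derivs_upto p f D" "j \<le> p"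
  shows "multilinear_form j (D j x)"
  using assms(2)
proof (induction j arbitrary: x)
  case (Suc j)
  have D: "((\<lambda>y. D j y hs) has_derivative (\<lambda>h. D (Suc j) x (h # hs))) (at x)" if "length hs = j" for hs
    using assms(1) Suc.prems that by (simp add: has_derivs_upto_def)
  have "multilinear_form j (\<lambda>hs. D (Suc j) x (h # hs))" for h
    by (rule multilinear_form_derivative[where F = "D j" and F' = "\<lambda>hs h. D (Suc j) x (h # hs)" and x = x])
       (use D Suc in auto)
  then show ?case using has_derivative_linear[OF D] by simp
qed simp

text \<open>On the reals \<open>Sup\<close> is known to be an upper bound only for sets bounded
  above, hence the appeal to multilinearity.\<close>

lemma le_multilin_norm:
  fixes T :: "'a::euclidean_space list \<Rightarrow> real"
  assumes "multilinear_form n T" "length hs = n" "\<forall>h\<in>set hs. norm h \<le> 1"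
  shows "T hs \<le> multilin_norm n T"
proof -
  obtain C where "\<forall>hs. length hs = n \<and> (\<forall>h\<in>set hs. norm h \<le> 1) \<longrightarrow> T hs \<le> C \<and> - T hs \<le> C"
    using multilinear_form_bounded[OF assms(1)] by blast
  then have "bdd_above {T hs |hs. length hs = n \<and> (\<forall>h\<in>set hs. norm h \<le> 1)}"
    by (intro bdd_aboveI[of _ C]) auto
  then show ?thesis unfolding multilin_norm_def using assms by (intro cSup_upper) auto
qed

text \<open>Taylor's formula for \<open>g\<close> paired with \<open>v\<close> along a ray. The
  coefficients \<open>c\<close> do not depend on \<open>\<tau>\<close>, so that expansions at
  several extrapolated points can be combined linearly; only \<open>c 0\<close> has to be known
  explicitly.\<close>

lemma gradient_taylor_unit:
  fixes f :: "'a::euclidean_space \<Rightarrow> real"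
  assumes grad: "\<And>x. (f has_derivative (\<lambda>h. g x \<bullet> h)) (at x)"
    and D: "has_derivs_upto p f D" and p: "p \<ge> 2"
    and Lip: "\<And>x y. multilin_norm p (\<lambda>hs. D p y hs - D p x hs) \<le> L * norm (y - x)" and L: "L \<ge> 0"
    and d: "norm d \<le> 1" and v: "norm v \<le> 1"
  shows "\<exists>c. c 0 = g x \<bullet> v \<and>
    (\<forall>\<tau>\<ge>0. \<bar>g (x + \<tau> *\<^sub>R d) \<bullet> v - (\<Sum>r<p. c r * \<tau> ^ r)\<bar> \<le> L / fact (p-1) * \<tau> ^ p)"
proof -
  have deriv: "((\<lambda>y. D j y hs) has_derivative (\<lambda>h. D (Suc j) x (h # hs))) (at x)"
    if "length hs = j" "j < p" for hs j x
    using D that by (simp add: has_derivs_upto_def)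
  have D1: "D 1 x [h] = g x \<bullet> h" for x h
  proof -
    have "D 0 x [] = f x" for x using D by (simp add: has_derivs_upto_def)
    then have "(f has_derivative (\<lambda>h. D 1 x [h])) (at x)" using deriv[of "[]" 0 x] p by simp
    then show ?thesis using fun_cong[OF has_derivative_unique[OF grad], of "\<lambda>h. D 1 x [h]" x h] by simp
  qed
  \<comment> \<open>Up to \<open>r = p - 1\<close>, \<open>\<phi> r\<close> is the
    \<open>r\<close>-th derivative of \<open>t \<mapsto> g (x + t *\<^sub>R d) \<bullet> v\<close>.
    New directions enter at the head, so \<open>v\<close> stays last.\<close>
  define \<phi> where "\<phi> = (\<lambda>r t. D (Suc r) (x + t *\<^sub>R d) (replicate r d @ [v]))"
  define q where "q = p - 1"
  have q: "p = Suc q" "q \<ge> 1" using p by (auto simp: q_def)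
  have der: "DERIV (\<phi> r) t :> \<phi> (Suc r) t" if "r < q" for r t
  proof -
    have "((\<lambda>y. D (Suc r) y (replicate r d @ [v])) has_derivative
        (\<lambda>h. D (Suc (Suc r)) (x + t *\<^sub>R d) (h # replicate r d @ [v]))) (at (x + t *\<^sub>R d))"
      using that q by (intro deriv) auto
    then have *: "((\<lambda>t. D (Suc r) (x + t *\<^sub>R d) (replicate r d @ [v])) has_derivative
        (\<lambda>s. D (Suc (Suc r)) (x + t *\<^sub>R d) ((s *\<^sub>R d) # replicate r d @ [v]))) (at t)"
      by (rule has_derivative_compose[rotated, where f = "\<lambda>t. x + t *\<^sub>R d"]) (auto intro!: derivative_eq_intros)
    have "multilinear_form (Suc (Suc r)) (D (Suc (Suc r)) (x + t *\<^sub>R d))"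
      using that q by (intro has_derivs_upto_multilinear[OF D]) auto
    then have "linear (\<lambda>h. D (Suc (Suc r)) (x + t *\<^sub>R d) (h # replicate r d @ [v]))" by simp
    from linear_scale[OF this] have "D (Suc (Suc r)) (x + t *\<^sub>R d) ((s *\<^sub>R d) # replicate r d @ [v]) = \<phi> (Suc r) t * s" for s
      by (simp add: \<phi>_def mult.commute)
    then have "(\<lambda>s. D (Suc (Suc r)) (x + t *\<^sub>R d) ((s *\<^sub>R d) # replicate r d @ [v])) = (*) (\<phi> (Suc r) t)"
      by (simp add: fun_eq_iff mult.commute)
    with * show ?thesis by (simp add: \<phi>_def has_field_derivative_def)
  qed
  have lip: "\<bar>\<phi> q t - \<phi> q 0\<bar> \<le> L * t" if t: "t \<ge> 0" for t
  proof -
    let ?hs = "replicate q d @ [v]"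
    have hs: "length ?hs = p" "\<forall>h\<in>set ?hs. norm h \<le> 1" using d v q by auto
    have "D p y ?hs - D p z ?hs \<le> L * norm (y - z)" for y z
      using le_multilin_norm[OF multilinear_form_diff[OF has_derivs_upto_multilinear[OF D order_refl, of y]
        has_derivs_upto_multilinear[OF D order_refl, of z]] hs] Lip[of y z] by linarith
    from this[of x "x + t *\<^sub>R d"] this[of "x + t *\<^sub>R d" x] have "\<bar>\<phi> q t - \<phi> q 0\<bar> \<le> L * (t * norm d)"
      using t by (auto simp: \<phi>_def q)
    also have "\<dots> \<le> L * (t * 1)" using L t d by (intro mult_left_mono) auto
    finally show ?thesis by simp
  qed
  show ?thesis
  proof (intro exI[of _ "\<lambda>r. \<phi> r 0 / fact r"] conjI allI impI)
    show "\<phi> 0 0 / fact 0 = g x \<bullet> v" using D1 by (simp add: \<phi>_def)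
    fix \<tau> :: real assume "\<tau> \<ge> 0"
    have g\<phi>: "g (x + \<tau> *\<^sub>R d) \<bullet> v = \<phi> 0 \<tau>" using D1 by (simp add: \<phi>_def)
    show "\<bar>g (x + \<tau> *\<^sub>R d) \<bullet> v - (\<Sum>r<p. \<phi> r 0 / fact r * \<tau> ^ r)\<bar> \<le> L / fact (p-1) * \<tau> ^ p"
    proof (cases "\<tau> = 0")
      case True
      have "(\<Sum>r<p. \<phi> r 0 / fact r * \<tau> ^ r) = \<phi> 0 0"
        unfolding q True by (subst sum.lessThan_Suc_shift) simp
      then show ?thesis using g\<phi> True L q by simp
    next
      case False
      then have pos: "\<tau> > 0" using \<open>\<tau> \<ge> 0\<close> by simp
      obtain t where t: "0 < t" "t \<le> \<tau>"
        and eq: "\<phi> 0 \<tau> = (\<Sum>r<q. \<phi> r 0 / fact r * \<tau> ^ r) + \<phi> q t / fact q * \<tau> ^ q"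
        using Maclaurin2[OF pos refl, of q \<phi>] der by blast
      \<comment> \<open>The Lagrange remainder at \<open>t\<close> is traded for the coefficient of
        order \<open>p - 1\<close> at 0; Lipschitz continuity of \<open>D p\<close> pays with one
        more power of \<open>\<tau>\<close>.\<close>
      have "g (x + \<tau> *\<^sub>R d) \<bullet> v - (\<Sum>r<p. \<phi> r 0 / fact r * \<tau> ^ r) = (\<phi> q t - \<phi> q 0) * (\<tau> ^ q / fact q)"
        unfolding g\<phi> eq by (simp add: q algebra_simps diff_divide_distrib)
      also have "\<bar>\<dots>\<bar> \<le> (L * t) * (\<tau> ^ q / fact q)"
        unfolding abs_mult using lip[of t] t pos by (intro mult_mono) auto
      also have "\<dots> \<le> (L * \<tau>) * (\<tau> ^ q / fact q)" using t L pos by (intro mult_right_mono mult_left_mono) auto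
      also have "\<dots> = L / fact (p-1) * \<tau> ^ p" by (simp add: q)
      finally show ?thesis .
    qed
  qed
qed

text \<open>Tested against one direction, the error is a combination of Taylor polynomials in
  \<open>u t * norm (y - x)\<close>. The moment conditions cancel the orders 1 to
  \<open>p - 1\<close> against \<open>g y\<close>, the term
  \<open>(1 - sum w S) *\<^sub>R g x\<close> repairs order 0, and only remainders survive.\<close>

lemma extrapolated_gradient_error:
  fixes f :: "'a::euclidean_space \<Rightarrow> real"
  assumes grad: "\<And>x. (f has_derivative (\<lambda>h. g x \<bullet> h)) (at x)"
    and D: "has_derivs_upto p f D" and p: "p \<ge> 2"
    and Lip: "\<And>x y. multilin_norm p (\<lambda>hs. D p y hs - D p x hs) \<le> L * norm (y - x)" and L: "L \<ge> 0"
    and u: "\<And>t. t \<in> S \<Longrightarrow> u t \<ge> 0"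
    and mom: "\<And>r. 1 \<le> r \<Longrightarrow> r < p \<Longrightarrow> (\<Sum>t\<in>S. w t * u t ^ r) = 1"
  shows "norm ((1 - sum w S) *\<^sub>R g x + (\<Sum>t\<in>S. w t *\<^sub>R g (x + u t *\<^sub>R (y - x))) - g y)
    \<le> L / fact (p-1) * norm (y - x) ^ p * (1 + (\<Sum>t\<in>S. \<bar>w t\<bar> * u t ^ p))" (is "norm ?e \<le> _")
proof -
  define \<delta> where "\<delta> = norm (y - x)"
  define d where "d = sgn (y - x)"
  \<comment> \<open>Pairing the error with its own direction recovers its norm;
    \<open>sgn 0 = 0\<close> covers a vanishing error.\<close>
  define v where "v = sgn ?e"
  have yx: "y - x = \<delta> *\<^sub>R d" by (cases "y = x") (simp_all add: \<delta>_def d_def sgn_div_norm)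
  have \<delta>: "\<delta> \<ge> 0" by (simp add: \<delta>_def)
  have "norm d \<le> 1" "norm v \<le> 1" by (simp_all add: d_def v_def norm_sgn)
  from gradient_taylor_unit[OF grad D p Lip L this, of x] obtain c where c0: "c 0 = g x \<bullet> v"
    and c: "\<And>\<tau>. \<tau> \<ge> 0 \<Longrightarrow> \<bar>g (x + \<tau> *\<^sub>R d) \<bullet> v - (\<Sum>r<p. c r * \<tau> ^ r)\<bar> \<le> L / fact (p-1) * \<tau> ^ p"
    by blast
  define \<rho> where "\<rho> = (\<lambda>\<tau>. g (x + \<tau> *\<^sub>R d) \<bullet> v - (\<Sum>r<p. c r * \<tau> ^ r))"
  have g\<rho>: "g (x + \<tau> *\<^sub>R d) \<bullet> v = \<rho> \<tau> + (\<Sum>r<p. c r * \<tau> ^ r)" for \<tau> by (simp add: \<rho>_def)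
  have gy: "g y \<bullet> v = \<rho> \<delta> + (\<Sum>r<p. c r * \<delta> ^ r)"
    using g\<rho>[of \<delta>] yx by (metis add.commute diff_add_cancel)
  have "(\<Sum>t\<in>S. w t * (\<Sum>r<p. c r * (u t * \<delta>) ^ r)) = (\<Sum>r<p. c r * \<delta> ^ r * (\<Sum>t\<in>S. w t * u t ^ r))"
    unfolding sum_distrib_left by (subst sum.swap) (simp add: power_mult_distrib ac_simps)
  \<comment> \<open>At \<open>r = 0\<close> the moment is \<open>sum w S\<close> instead of 1; the
    excess meets \<open>c 0 = g x \<bullet> v\<close> and cancels later.\<close>
  also have "\<dots> = (\<Sum>r<p. c r * \<delta> ^ r * (if r = 0 then sum w S else 1))"
    using mom by (intro sum.cong) auto
  also have "\<dots> = (\<Sum>r<p. c r * \<delta> ^ r) + c 0 * (sum w S - 1)"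
  proof -
    obtain q where "p = Suc q" using p by (cases p) auto
    then show ?thesis by (simp add: sum.lessThan_Suc_shift algebra_simps del: sum.lessThan_Suc)
  qed
  finally have mid: "(\<Sum>t\<in>S. w t * (\<Sum>r<p. c r * (u t * \<delta>) ^ r)) = (\<Sum>r<p. c r * \<delta> ^ r) + c 0 * (sum w S - 1)" .
  have "norm ?e = ?e \<bullet> v"
  proof -
    have "norm z = z \<bullet> sgn z" for z :: 'a
      by (cases "z = 0") (simp_all add: sgn_div_norm dot_square_norm power2_eq_square)
    then show ?thesis unfolding v_def .
  qed
  also have "\<dots> = (1 - sum w S) * c 0 + (\<Sum>t\<in>S. w t * (g (x + (u t * \<delta>) *\<^sub>R d) \<bullet> v)) - g y \<bullet> v"
    unfolding yx by (simp add: inner_diff_left inner_add_left inner_sum_left c0)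
  also have "\<dots> = (\<Sum>t\<in>S. w t * \<rho> (u t * \<delta>)) - \<rho> \<delta>"
    unfolding g\<rho> gy distrib_left sum.distrib mid by (simp add: algebra_simps)
  also have "\<dots> \<le> (\<Sum>t\<in>S. \<bar>w t\<bar> * (L / fact (p-1) * (u t * \<delta>) ^ p)) + L / fact (p-1) * \<delta> ^ p"
  proof -
    have "w t * \<rho> (u t * \<delta>) \<le> \<bar>w t\<bar> * (L / fact (p-1) * (u t * \<delta>) ^ p)" if "t \<in> S" for t
    proof -
      have "w t * \<rho> (u t * \<delta>) \<le> \<bar>w t\<bar> * \<bar>\<rho> (u t * \<delta>)\<bar>" by (metis abs_ge_self abs_mult)
      also have "\<dots> \<le> \<bar>w t\<bar> * (L / fact (p-1) * (u t * \<delta>) ^ p)"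
        using c[of "u t * \<delta>"] u[OF that] \<delta> by (intro mult_left_mono) (auto simp: \<rho>_def)
      finally show ?thesis .
    qed
    moreover have "- \<rho> \<delta> \<le> L / fact (p-1) * \<delta> ^ p" using c[OF \<delta>] by (simp add: \<rho>_def)
    ultimately show ?thesis
      using sum_mono[of S "\<lambda>t. w t * \<rho> (u t * \<delta>)" "\<lambda>t. \<bar>w t\<bar> * (L / fact (p-1) * (u t * \<delta>) ^ p)"]
      by (simp add: add_mono[of _ _ "- \<rho> \<delta>", simplified])
  qed
  also have "\<dots> = L / fact (p-1) * \<delta> ^ p * (1 + (\<Sum>t\<in>S. \<bar>w t\<bar> * u t ^ p))"
    by (simp add: distrib_left sum_distrib_left sum_divide_distrib power_mult_distrib ac_simps)
  finally show ?thesis by (simp add: \<delta>_def)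
qed

section \<open>Descent and second moments\<close>

text \<open>The descent lemma: Lipschitz continuity of \<open>g\<close> makes the derivative of the
  gap \<open>\<phi>\<close> nonpositive on [0, 1].\<close>

lemma smooth_upper_bound:
  fixes f :: "'a::euclidean_space \<Rightarrow> real"
  assumes grad: "\<And>x. (f has_derivative (\<lambda>h. g x \<bullet> h)) (at x)"
    and Lip: "\<And>x y. norm (g y - g x) \<le> L * norm (y - x)"
  shows "f (x + h) \<le> f x + g x \<bullet> h + L / 2 * (norm h)\<^sup>2"
proof -
  define \<phi> where "\<phi> = (\<lambda>t::real. f (x + t *\<^sub>R h) - t * (g x \<bullet> h) - L / 2 * t\<^sup>2 * (norm h)\<^sup>2)"
  have "\<phi> 1 \<le> \<phi> 0"
  proof (rule DERIV_nonpos_imp_nonincreasing[of 0 1 \<phi>])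
    fix t :: real assume t: "0 \<le> t" "t \<le> 1"
    have "((\<lambda>t. f (x + t *\<^sub>R h)) has_derivative (\<lambda>s. g (x + t *\<^sub>R h) \<bullet> (s *\<^sub>R h))) (at t)"
      by (rule has_derivative_compose[OF _ grad, where f = "\<lambda>t. x + t *\<^sub>R h"]) (auto intro!: derivative_eq_intros)
    moreover have "(\<lambda>s. g (x + t *\<^sub>R h) \<bullet> (s *\<^sub>R h)) = (*) (g (x + t *\<^sub>R h) \<bullet> h)" by (simp add: fun_eq_iff)
    ultimately have "((\<lambda>t. f (x + t *\<^sub>R h)) has_field_derivative (g (x + t *\<^sub>R h) \<bullet> h)) (at t)"
      by (simp add: has_field_derivative_def)
    then have "(\<phi> has_field_derivative (g (x + t *\<^sub>R h) \<bullet> h - g x \<bullet> h - L * t * (norm h)\<^sup>2)) (at t)"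
      unfolding \<phi>_def by (auto intro!: derivative_eq_intros)
    moreover have "g (x + t *\<^sub>R h) \<bullet> h - g x \<bullet> h \<le> L * t * (norm h)\<^sup>2"
    proof -
      have "g (x + t *\<^sub>R h) \<bullet> h - g x \<bullet> h \<le> norm (g (x + t *\<^sub>R h) - g x) * norm h"
        by (metis inner_diff_left norm_cauchy_schwarz)
      also have "\<dots> \<le> L * norm (t *\<^sub>R h) * norm h"
        using Lip[where y = "x + t *\<^sub>R h" and x = x] by (intro mult_right_mono) auto
      finally show ?thesis using t by (simp add: power2_eq_square mult.assoc)
    qed
    ultimately show "\<exists>y. (\<phi> has_field_derivative y) (at t) \<and> y \<le> 0" by fastforce
  qed simp
  then show ?thesis by (simp add: \<phi>_def)
qed

text \<open>The junk value \<open>e / norm 0 = 0\<close> leaves \<open>x\<close> fixed when \<open>m = 0\<close>; the inequality survives because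
  then \<open>norm (m - g x) = norm (g x)\<close>.\<close>
lemma normalized_step_descent:
  fixes f :: "'a::euclidean_space \<Rightarrow> real"
  assumes grad: "\<And>x. (f has_derivative (\<lambda>h. g x \<bullet> h)) (at x)"
    and Lip: "\<And>x y. norm (g y - g x) \<le> L * norm (y - x)" and L: "L \<ge> 0" and e: "e \<ge> 0"
  shows "f (x - (e / norm m) *\<^sub>R m) + e * norm (g x) \<le> f x + 2 * e * norm (m - g x) + L / 2 * e\<^sup>2"
proof (cases "m = 0")
  case True
  then show ?thesis using L e by simp
next
  case False
  define h where "h = - (e / norm m) *\<^sub>R m"
  have nh: "norm h = e" using False e by (simp add: h_def)
  have "g x \<bullet> h = - e * norm m + (e / norm m) * ((m - g x) \<bullet> m)"
    using False by (simp add: h_def inner_diff_left dot_square_norm power2_eq_square field_simps)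
  also have "\<dots> \<le> - e * norm m + (e / norm m) * (norm (m - g x) * norm m)"
    using e by (intro add_left_mono mult_left_mono norm_cauchy_schwarz) auto
  also have "\<dots> = e * norm (m - g x) - e * norm m" using False by simp
  finally have "g x \<bullet> h \<le> e * norm (m - g x) - e * norm m" .
  \<comment> \<open>The second copy of \<open>e * norm (m - g x)\<close>, paid for replacing
    \<open>norm m\<close> by \<open>norm (g x)\<close>; the two copies give the factor 2.\<close>
  moreover have "e * norm (g x) \<le> e * (norm m + norm (m - g x))"
    using e norm_triangle_sub[of "g x" m] by (intro mult_left_mono) (auto simp: norm_minus_commute)
  ultimately show ?thesis
    using smooth_upper_bound[OF grad Lip, of x h] nh by (simp add: h_def algebra_simps)
qed

text \<open>Convexity of the square: the vector is a convex combination of \<open>e\<close> and of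
  \<open>r\<close> divided by \<open>\<theta>\<close>, with weights \<open>1 - \<theta>\<close> and
  \<open>\<theta>\<close>.\<close>

lemma norm_add_sq_contract:
  fixes e r :: "'a::real_inner"
  assumes "0 < \<theta>" "\<theta> \<le> 1" "norm r \<le> R"
  shows "(norm ((1 - \<theta>) *\<^sub>R e + r))\<^sup>2 \<le> (1 - \<theta>) * (norm e)\<^sup>2 + R\<^sup>2 / \<theta>"
proof -
  have "norm ((1 - \<theta>) *\<^sub>R e + r) \<le> (1 - \<theta>) * norm e + R"
    using norm_triangle_ineq[of "(1 - \<theta>) *\<^sub>R e" r] assms by simp
  then have "(norm ((1 - \<theta>) *\<^sub>R e + r))\<^sup>2 \<le> ((1 - \<theta>) * norm e + R)\<^sup>2"
    by (intro power_mono) auto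
  also have "\<dots> \<le> (1 - \<theta>) * (norm e)\<^sup>2 + R\<^sup>2 / \<theta>"
  proof -
    have "(1 - \<theta>) * (norm e)\<^sup>2 + R\<^sup>2 / \<theta> - ((1 - \<theta>) * norm e + R)\<^sup>2 = (1 - \<theta>) * (\<theta> * norm e - R)\<^sup>2 / \<theta>"
      using assms(1) by (simp add: field_simps power2_eq_square)
    also have "\<dots> \<ge> 0" using assms by simp
    finally show ?thesis by simp
  qed
  finally show ?thesis .
qed

section \<open>Second moments of weighted noise\<close>

lemma norm_weighted_sum_sq_le:
  fixes z :: "'i \<Rightarrow> 'a::real_normed_vector"
  shows "(norm (\<Sum>t\<in>S. w t *\<^sub>R z t))\<^sup>2 \<le> (\<Sum>t\<in>S. \<bar>w t\<bar>) * (\<Sum>t\<in>S. \<bar>w t\<bar> * (norm (z t))\<^sup>2)"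
proof -
  have "norm (\<Sum>t\<in>S. w t *\<^sub>R z t) \<le> (\<Sum>t\<in>S. sqrt \<bar>w t\<bar> * (sqrt \<bar>w t\<bar> * norm (z t)))"
    by (rule order_trans[OF norm_sum]) (simp add: mult.assoc[symmetric])
  then have "(norm (\<Sum>t\<in>S. w t *\<^sub>R z t))\<^sup>2 \<le> (\<Sum>t\<in>S. sqrt \<bar>w t\<bar> * (sqrt \<bar>w t\<bar> * norm (z t)))\<^sup>2"
    by (intro power_mono) auto
  also have "\<dots> \<le> (\<Sum>t\<in>S. (sqrt \<bar>w t\<bar>)\<^sup>2) * (\<Sum>t\<in>S. (sqrt \<bar>w t\<bar> * norm (z t))\<^sup>2)"
    by (rule Cauchy_Schwarz_ineq_sum)
  finally show ?thesis by (simp add: power_mult_distrib)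
qed

text \<open>Expanding the square leaves a cross term \<open>2 * (v \<bullet> N e)\<close> of mean
  zero. The square-integrability behind this is available unless the right side is infinite.\<close>

lemma (in prob_space) nn_integral_norm_sq_shift:
  fixes N :: "'a \<Rightarrow> 'b::euclidean_space"
  assumes int: "integrable M N" and mean: "integral\<^sup>L M N = 0"
  shows "(\<integral>\<^sup>+ e. ennreal ((norm (v + N e))\<^sup>2) \<partial>M) \<le> ennreal ((norm v)\<^sup>2) + (\<integral>\<^sup>+ e. ennreal ((norm (N e))\<^sup>2) \<partial>M)"
proof (cases "(\<integral>\<^sup>+ e. ennreal ((norm (N e))\<^sup>2) \<partial>M) = \<infinity>")
  case True
  then show ?thesis by simp
next
  case False
  have [measurable]: "N \<in> borel_measurable M" using int by simp
  have sq: "integrable M (\<lambda>e. (norm (N e))\<^sup>2)"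
    using False by (intro integrableI_nonneg) (auto simp: less_top)
  have eq: "(norm (v + N e))\<^sup>2 = (norm v)\<^sup>2 + (2 * (v \<bullet> N e) + (norm (N e))\<^sup>2)" for e
    by (simp add: power2_norm_eq_inner inner_add_left inner_add_right inner_commute)
  have i2: "integrable M (\<lambda>e. (norm (v + N e))\<^sup>2)"
    unfolding eq using int sq by (intro Bochner_Integration.integrable_add) auto
  have "(\<integral>\<^sup>+ e. ennreal ((norm (v + N e))\<^sup>2) \<partial>M) = ennreal (\<integral>e. (norm (v + N e))\<^sup>2 \<partial>M)"
    using i2 by (intro nn_integral_eq_integral) auto
  also have "(\<integral>e. (norm (v + N e))\<^sup>2 \<partial>M) = (norm v)\<^sup>2 + (\<integral>e. (norm (N e))\<^sup>2 \<partial>M)"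
    unfolding eq using int sq mean by (simp add: prob_space)
  also have "ennreal \<dots> = ennreal ((norm v)\<^sup>2) + (\<integral>\<^sup>+ e. ennreal ((norm (N e))\<^sup>2) \<partial>M)"
    using sq by (simp add: nn_integral_eq_integral ennreal_plus integral_nonneg_AE)
  finally show ?thesis by simp
qed

text \<open>One sample \<open>e\<close> enters all \<open>Z t\<close>, so their noises may be
  correlated; Cauchy-Schwarz with weights \<open>\<bar>w t\<bar>\<close> yields the square of the
  sum of these weights.\<close>

lemma (in prob_space) second_moment_weighted_sum:
  fixes Z :: "'i \<Rightarrow> 'a \<Rightarrow> 'b::euclidean_space"
  assumes fin: "finite S"
    and Z: "\<And>t. t \<in> S \<Longrightarrow> has_bochner_integral M (Z t) (\<mu> t)"
    and var: "\<And>t. t \<in> S \<Longrightarrow> (\<integral>\<^sup>+ e. ennreal ((norm (Z t e - \<mu> t))\<^sup>2) \<partial>M) \<le> ennreal (\<sigma>\<^sup>2)"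
  shows "(\<integral>\<^sup>+ e. ennreal ((norm (b + (\<Sum>t\<in>S. w t *\<^sub>R Z t e)))\<^sup>2) \<partial>M)
    \<le> ennreal ((norm (b + (\<Sum>t\<in>S. w t *\<^sub>R \<mu> t)))\<^sup>2 + (\<Sum>t\<in>S. \<bar>w t\<bar>)\<^sup>2 * \<sigma>\<^sup>2)"
proof -
  define N where "N = (\<lambda>e. \<Sum>t\<in>S. w t *\<^sub>R (Z t e - \<mu> t))"
  have hb: "has_bochner_integral M (\<lambda>e. Z t e - \<mu> t) 0" if "t \<in> S" for t
    using has_bochner_integral_diff[OF Z[OF that], of "\<lambda>_. \<mu> t" "\<mu> t"]
    by (simp add: has_bochner_integral_iff prob_space)
  have meas: "(\<lambda>e. Z t e - \<mu> t) \<in> borel_measurable M" if "t \<in> S" for t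
    using hb[OF that] by (auto simp: has_bochner_integral_iff)
  have int: "has_bochner_integral M N (\<Sum>t\<in>S. w t *\<^sub>R 0)"
    unfolding N_def using hb by (intro has_bochner_integral_sum has_bochner_integral_scaleR_right) auto
  have shift: "b + (\<Sum>t\<in>S. w t *\<^sub>R Z t e) = (b + (\<Sum>t\<in>S. w t *\<^sub>R \<mu> t)) + N e" for e
    by (simp add: N_def scaleR_diff_right sum_subtractf)
  have "(\<integral>\<^sup>+ e. ennreal ((norm (N e))\<^sup>2) \<partial>M)
      \<le> (\<integral>\<^sup>+ e. (\<Sum>t\<in>S. ennreal ((\<Sum>t\<in>S. \<bar>w t\<bar>) * \<bar>w t\<bar>) * ennreal ((norm (Z t e - \<mu> t))\<^sup>2)) \<partial>M)"
    using norm_weighted_sum_sq_le[of w _ S]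
    by (intro nn_integral_mono)
       (simp add: N_def ennreal_mult[symmetric] sum_nonneg sum_distrib_left mult.assoc sum_ennreal)
  also have "\<dots> = (\<Sum>t\<in>S. ennreal ((\<Sum>t\<in>S. \<bar>w t\<bar>) * \<bar>w t\<bar>) * (\<integral>\<^sup>+ e. ennreal ((norm (Z t e - \<mu> t))\<^sup>2) \<partial>M))"
    using meas by (simp add: nn_integral_sum nn_integral_cmult)
  also have "\<dots> \<le> (\<Sum>t\<in>S. ennreal ((\<Sum>t\<in>S. \<bar>w t\<bar>) * \<bar>w t\<bar>) * ennreal (\<sigma>\<^sup>2))"
    using var by (intro sum_mono mult_left_mono) auto
  also have "\<dots> = (\<Sum>t\<in>S. ennreal ((\<Sum>t\<in>S. \<bar>w t\<bar>) * \<bar>w t\<bar> * \<sigma>\<^sup>2))"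
    by (intro sum.cong refl ennreal_mult[symmetric] mult_nonneg_nonneg sum_nonneg) auto
  also have "\<dots> = ennreal (\<Sum>t\<in>S. (\<Sum>t\<in>S. \<bar>w t\<bar>) * \<bar>w t\<bar> * \<sigma>\<^sup>2)"
    by (intro sum_ennreal mult_nonneg_nonneg sum_nonneg) auto
  also have "(\<Sum>t\<in>S. (\<Sum>t\<in>S. \<bar>w t\<bar>) * \<bar>w t\<bar> * \<sigma>\<^sup>2) = (\<Sum>t\<in>S. \<bar>w t\<bar>)\<^sup>2 * \<sigma>\<^sup>2"
    by (simp only: sum_distrib_left[symmetric] sum_distrib_right[symmetric] power2_eq_square[of "sum _ _"])
  finally have "(\<integral>\<^sup>+ e. ennreal ((norm (N e))\<^sup>2) \<partial>M) \<le> ennreal ((\<Sum>t\<in>S. \<bar>w t\<bar>)\<^sup>2 * \<sigma>\<^sup>2)" .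
  moreover have "(\<integral>\<^sup>+ e. ennreal ((norm ((b + (\<Sum>t\<in>S. w t *\<^sub>R \<mu> t)) + N e))\<^sup>2) \<partial>M)
      \<le> ennreal ((norm (b + (\<Sum>t\<in>S. w t *\<^sub>R \<mu> t)))\<^sup>2) + (\<integral>\<^sup>+ e. ennreal ((norm (N e))\<^sup>2) \<partial>M)"
    using int by (intro nn_integral_norm_sq_shift) (auto simp: has_bochner_integral_iff)
  ultimately show ?thesis
    unfolding shift by (simp add: ennreal_plus order_trans[OF _ add_left_mono])
qed

section \<open>Integrating out an independent variable\<close>

lemma (in prob_space) nn_integral_indep_pair:
  assumes ind: "indep_var S X T Y" and h: "h \<in> borel_measurable (S \<Otimes>\<^sub>M T)"
  shows "(\<integral>\<^sup>+ \<omega>. h (X \<omega>, Y \<omega>) \<partial>M) = (\<integral>\<^sup>+ \<omega>. (\<integral>\<^sup>+ y. h (X \<omega>, y) \<partial>distr M T Y) \<partial>M)"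
proof -
  have rv [measurable]: "X \<in> measurable M S" "Y \<in> measurable M T"
    and eq: "distr M S X \<Otimes>\<^sub>M distr M T Y = distr M (S \<Otimes>\<^sub>M T) (\<lambda>x. (X x, Y x))"
    using ind by (auto simp: indep_var_distribution_eq)
  interpret Y: prob_space "distr M T Y" by (rule prob_space_distr) fact
  have h': "h \<in> borel_measurable (distr M S X \<Otimes>\<^sub>M distr M T Y)"
    using h by (simp cong: measurable_cong_sets)
  have h2: "h \<in> borel_measurable (S \<Otimes>\<^sub>M distr M T Y)"
    using h by (simp cong: measurable_cong_sets)
  have "(\<integral>\<^sup>+ \<omega>. h (X \<omega>, Y \<omega>) \<partial>M) = (\<integral>\<^sup>+ z. h z \<partial>distr M (S \<Otimes>\<^sub>M T) (\<lambda>x. (X x, Y x)))"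
    using h by (subst nn_integral_distr) auto
  also have "\<dots> = (\<integral>\<^sup>+ x. (\<integral>\<^sup>+ y. h (x, y) \<partial>distr M T Y) \<partial>distr M S X)"
    unfolding eq[symmetric] by (rule Y.nn_integral_fst[OF h', symmetric])
  also have "\<dots> = (\<integral>\<^sup>+ \<omega>. (\<integral>\<^sup>+ y. h (X \<omega>, y) \<partial>distr M T Y) \<partial>M)"
    using Y.borel_measurable_nn_integral_fst[OF h2] by (subst nn_integral_distr) auto
  finally show ?thesis .
qed

text \<open>Independence is available for blocks of samples, while the integrand sees functions of
  the blocks: \<open>\<phi>\<close> will compute the state from the past block and
  \<open>\<psi>\<close> will extract a single sample.\<close>

lemma (in prob_space) nn_integral_indep_compose:
  assumes ind: "indep_var S X T Y"
    and \<phi>: "\<phi> \<in> measurable S S'" and \<psi>: "\<psi> \<in> measurable T T'"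
    and h: "h \<in> borel_measurable (S' \<Otimes>\<^sub>M T')"
  shows "(\<integral>\<^sup>+ \<omega>. h (\<phi> (X \<omega>), \<psi> (Y \<omega>)) \<partial>M) =
    (\<integral>\<^sup>+ \<omega>. (\<integral>\<^sup>+ y. h (\<phi> (X \<omega>), y) \<partial>distr M T' (\<lambda>\<omega>. \<psi> (Y \<omega>))) \<partial>M)"
proof -
  have X: "X \<in> measurable M S" and Y: "Y \<in> measurable M T"
    using ind by (auto simp: indep_var_distribution_eq)
  have hm: "(\<lambda>z. h (\<phi> (fst z), \<psi> (snd z))) \<in> borel_measurable (S \<Otimes>\<^sub>M T)"
    using \<phi> \<psi> h by measurable
  have "(\<integral>\<^sup>+ y. h (\<phi> (X \<omega>), \<psi> y) \<partial>distr M T Y) = (\<integral>\<^sup>+ y. h (\<phi> (X \<omega>), y) \<partial>distr M T' (\<lambda>\<omega>. \<psi> (Y \<omega>)))"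
    if \<omega>: "\<omega> \<in> space M" for \<omega>
  proof -
    have "\<phi> (X \<omega>) \<in> space S'" using \<omega> X \<phi> by (auto dest: measurable_space)
    then have h1: "(\<lambda>y. h (\<phi> (X \<omega>), y)) \<in> borel_measurable T'" using h by measurable
    have "distr M T' (\<lambda>\<omega>. \<psi> (Y \<omega>)) = distr (distr M T Y) T' \<psi>"
      using Y \<psi> by (simp add: distr_distr o_def)
    then show ?thesis using h1 \<psi> by (simp add: nn_integral_distr)
  qed
  then show ?thesis
    using nn_integral_indep_pair[OF ind hm] by (auto intro!: nn_integral_cong)
qed

section \<open>Parameter schedules\<close>

lemma theta_node_ge_1: "p \<ge> 2 \<Longrightarrow> theta_node p k \<ge> 1"
  by (simp add: theta_node_def ge_one_powr_ge_zero)

lemma sum_theta_p: "(\<Sum>t\<in>{1..p-1}. theta_p p k t) = (\<Sum>t\<in>{1..p-1}. lagrange_weight (p-1) (theta_node p k) t)"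
  by (intro sum.cong refl theta_p_eq_lagrange_weight)

lemma sum_theta_p_bounds:
  assumes "p \<ge> 2"
  shows "1 / theta_node p k \<le> (\<Sum>t\<in>{1..p-1}. theta_p p k t)" "(\<Sum>t\<in>{1..p-1}. theta_p p k t) \<le> 1"
  unfolding sum_theta_p using sum_lagrange_weight_bounds[OF theta_node_ge_1, of p "p-1"] assms by auto

lemma abs_theta_p_le:
  assumes "p \<ge> 2" "t \<in> {1..p-1}"
  shows "\<bar>theta_p p k t\<bar> \<le> fact (p-1) / (real t * theta_node p k)"
  using abs_lagrange_weight_le[OF theta_node_ge_1] assms by (simp add: theta_p_eq_lagrange_weight)

lemma gamma_p_eq: "gamma_p p k t = 1 / (real t * theta_node p k)"
  by (simp add: gamma_p_def theta_node_def)

lemma theta_p_moment: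
  assumes "p \<ge> 2" "1 \<le> r" "r < p"
  shows "(\<Sum>t\<in>{1..p-1}. theta_p p k t * (1 / gamma_p p k t) ^ r) = 1"
proof -
  have "theta_node p k > 0" using theta_node_ge_1[OF assms(1), of k] by linarith
  moreover have "(\<Sum>t\<in>{1..p-1}. theta_p p k t * (1 / gamma_p p k t) ^ r)
      = (\<Sum>t\<in>{1..p-1}. lagrange_weight (p-1) (theta_node p k) t * (real t * theta_node p k) ^ r)"
    by (intro sum.cong refl) (simp add: gamma_p_eq theta_p_eq_lagrange_weight)
  ultimately show ?thesis using sum_lagrange_weight_power[of "theta_node p k" r "p-1"] assms by simp
qed

lemma sum_abs_theta_p_le:
  assumes "p \<ge> 2"
  shows "(\<Sum>t\<in>{1..p-1}. \<bar>theta_p p k t\<bar>) \<le> fact p / theta_node p k"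
proof -
  have a: "theta_node p k \<ge> 1" by (rule theta_node_ge_1[OF assms])
  have "\<bar>theta_p p k t\<bar> \<le> fact (p-1) / theta_node p k" if t: "t \<in> {1..p-1}" for t
    by (rule order_trans[OF abs_theta_p_le[OF assms t]]) (use t a in \<open>auto simp: divide_simps\<close>)
  then have "(\<Sum>t\<in>{1..p-1}. \<bar>theta_p p k t\<bar>) \<le> real (p-1) * (fact (p-1) / theta_node p k)"
    using sum_bounded_above[of "{1..p-1}" "\<lambda>t. \<bar>theta_p p k t\<bar>" "fact (p-1) / theta_node p k"] by simp
  also have "\<dots> \<le> real p * (fact (p-1) / theta_node p k)" using a by (intro mult_right_mono) auto
  also have "\<dots> = fact p / theta_node p k" using assms by (simp add: fact_reduce)
  finally show ?thesis .
qed

text \<open>This is the constant of \<open>extrapolated_gradient_error\<close> for the prescribed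
  weights. Up to the common factor \<open>fact (p-1) * theta_node p k ^ (p-1)\<close>, the
  \<open>p - 1\<close> summands total at most \<open>(p - 1) ^ p\<close>, and the leading 1 is
  absorbed by \<open>(p - 1) ^ p + 1 \<le> p ^ p\<close>.\<close>

lemma sum_abs_theta_p_power_le:
  assumes "p \<ge> 2"
  shows "(1 + (\<Sum>t\<in>{1..p-1}. \<bar>theta_p p k t\<bar> * (1 / gamma_p p k t) ^ p)) / fact (p-1)
    \<le> real p ^ p * theta_node p k ^ (p-1)"
proof -
  define a where "a = theta_node p k"
  define q where "q = p - 1"
  have q: "p = Suc q" "q \<ge> 1" using assms by (auto simp: q_def)
  have a: "a \<ge> 1" unfolding a_def by (rule theta_node_ge_1[OF assms])
  have "(\<Sum>t\<in>{1..p-1}. \<bar>theta_p p k t\<bar> * (1 / gamma_p p k t) ^ p)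
      \<le> (\<Sum>t\<in>{1..p-1}. fact q * (real q ^ q * a ^ q))"
  proof (intro sum_mono)
    fix t assume t: "t \<in> {1..p-1}"
    have "\<bar>theta_p p k t\<bar> * (1 / gamma_p p k t) ^ p \<le> fact q / (real t * a) * (real t * a) ^ p"
      using abs_theta_p_le[OF assms t, of k] a
      by (intro mult_mono) (auto simp: a_def q_def gamma_p_eq)
    also have "\<dots> = fact q * (real t ^ q * a ^ q)" using t a by (simp add: q power_mult_distrib)
    also have "\<dots> \<le> fact q * (real q ^ q * a ^ q)"
      using t a q by (intro mult_left_mono mult_right_mono power_mono) auto
    finally show "\<bar>theta_p p k t\<bar> * (1 / gamma_p p k t) ^ p \<le> fact q * (real q ^ q * a ^ q)" .
  qed
  also have "\<dots> = fact q * (real q ^ p * a ^ q)" by (simp add: q)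
  finally have "1 + (\<Sum>t\<in>{1..p-1}. \<bar>theta_p p k t\<bar> * (1 / gamma_p p k t) ^ p) \<le> fact q * a ^ q + fact q * (real q ^ p * a ^ q)"
    using a mult_mono[of 1 "fact q::real" 1 "a ^ q"] by (simp add: fact_ge_1)
  also have "\<dots> = fact q * ((real q ^ p + 1) * a ^ q)" by (simp add: algebra_simps)
  also have "\<dots> \<le> fact q * (real p ^ p * a ^ q)"
  proof -
    have "q ^ p < p ^ p" using q by (intro power_strict_mono) auto
    then have "q ^ p + 1 \<le> p ^ p" by simp
    then have "real (q ^ p + 1) \<le> real (p ^ p)" by (simp only: of_nat_le_iff)
    then have "real q ^ p + 1 \<le> real p ^ p" by simp
    then show ?thesis using a by (intro mult_left_mono mult_right_mono) auto
  qed
  finally show ?thesis by (simp add: a_def q_def divide_le_eq mult.commute)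
qed

text \<open>The Lyapunov weight \<open>W\<close> on the squared error. With \<open>a\<close> for
  \<open>theta_node\<close>, its exponent makes three quantities exactly \<open>1 / (k + p)\<close>:
  \<open>\<eta>^2 * a / W\<close> from Young's inequality, the weighted bias
  \<open>W * (\<eta>^p * a^(p-1))^2 * a\<close> and the weighted variance
  \<open>W / a^2\<close>.\<close>

definition lyap_weight :: "nat \<Rightarrow> nat \<Rightarrow> real" where
  "lyap_weight p k = (real k + real p) powr ((real p - 1) / (3 * real p + 1))"

lemma lyap_weight_pos: "p \<ge> 2 \<Longrightarrow> lyap_weight p k > 0"
  by (simp add: lyap_weight_def)

lemma eta_p_powr: "eta_p p k = (real k + real p) powr (- ((2 * real p + 1) / (3 * real p + 1)))"
  by (simp only: eta_p_def powr_minus_divide)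

text \<open>The shapes, down to \<open>real 2\<close>, are those that arise from collecting powers
  of \<open>real k + real p\<close> in the next three lemmas. With \<open>i\<close> the inverse of
  the common denominator, each is a polynomial consequence of
  \<open>i * (3 * r + 1) = 1\<close>.\<close>

lemma schedule_exponents:
  fixes r :: real
  assumes "r \<ge> 0"
  shows "- ((2 * r + 1) / (3 * r + 1)) * real 2 + 2 * r / (3 * r + 1) = (r - 1) / (3 * r + 1) + - 1"
    and "(r - 1) / (3 * r + 1) + ((- ((2 * r + 1) / (3 * r + 1)) * r + 2 * r / (3 * r + 1) * (r - 1)) * real 2
      + 2 * r / (3 * r + 1)) = - 1"
    and "(r - 1) / (3 * r + 1) - 2 * r / (3 * r + 1) * real 2 = - 1"
proof -
  define i where "i = inverse (3 * r + 1)"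
  have i: "i * (3 * r + 1) = 1" using assms by (simp add: i_def)
  show "- ((2 * r + 1) / (3 * r + 1)) * real 2 + 2 * r / (3 * r + 1) = (r - 1) / (3 * r + 1) + - 1"
    unfolding divide_inverse i_def[symmetric] using i by (simp, algebra)
  show "(r - 1) / (3 * r + 1) + ((- ((2 * r + 1) / (3 * r + 1)) * r + 2 * r / (3 * r + 1) * (r - 1)) * real 2
      + 2 * r / (3 * r + 1)) = - 1"
    unfolding divide_inverse i_def[symmetric] using i by (simp, algebra)
  show "(r - 1) / (3 * r + 1) - 2 * r / (3 * r + 1) * real 2 = - 1"
    unfolding divide_inverse i_def[symmetric] using i by (simp, algebra)
qed

lemma eta_p_sq_node:
  assumes "p \<ge> 2"
  shows "(eta_p p k)\<^sup>2 * theta_node p k = lyap_weight p k / (real k + real p)"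
proof -
  define u where "u = real k + real p"
  have u: "u > 0" using assms by (simp add: u_def)
  then have pw: "(u powr e) ^ n = u powr (e * real n)" for e n by (simp add: powr_power mult.commute)
  have "(eta_p p k)\<^sup>2 * theta_node p k
      = u powr (- ((2 * real p + 1) / (3 * real p + 1)) * real 2 + 2 * real p / (3 * real p + 1))"
    by (simp only: eta_p_powr theta_node_def u_def[symmetric] pw powr_add)
  also have "\<dots> = lyap_weight p k * u powr - 1"
    by (simp only: schedule_exponents(1)[of "real p"] of_nat_0_le_iff powr_add lyap_weight_def u_def)
  finally show ?thesis using u by (simp add: u_def powr_minus_divide)
qed

lemma lyap_weight_bias:
  assumes "p \<ge> 2"
  shows "lyap_weight p k * ((eta_p p k ^ p * theta_node p k ^ (p-1))\<^sup>2 * theta_node p k) = 1 / (real k + real p)"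
proof -
  define u where "u = real k + real p"
  have u: "u > 0" using assms by (simp add: u_def)
  then have pw: "(u powr e) ^ n = u powr (e * real n)" for e n by (simp add: powr_power mult.commute)
  have p1: "real (p - 1) = real p - 1" using assms by simp
  have "lyap_weight p k * ((eta_p p k ^ p * theta_node p k ^ (p-1))\<^sup>2 * theta_node p k)
      = u powr ((real p - 1) / (3 * real p + 1) + ((- ((2 * real p + 1) / (3 * real p + 1)) * real p
          + 2 * real p / (3 * real p + 1) * (real p - 1)) * real 2 + 2 * real p / (3 * real p + 1)))"
    by (simp only: eta_p_powr theta_node_def lyap_weight_def u_def[symmetric] pw p1 powr_add[symmetric])
  also have "\<dots> = u powr - 1"
    by (simp only: schedule_exponents(2)[of "real p"] of_nat_0_le_iff)
  finally show ?thesis using u by (simp add: u_def powr_minus_divide)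
qed

lemma lyap_weight_variance:
  assumes "p \<ge> 2"
  shows "lyap_weight p k / (theta_node p k)\<^sup>2 = 1 / (real k + real p)"
proof -
  define u where "u = real k + real p"
  have u: "u > 0" using assms by (simp add: u_def)
  then have pw: "(u powr e) ^ n = u powr (e * real n)" for e n by (simp add: powr_power mult.commute)
  have "lyap_weight p k / (theta_node p k)\<^sup>2 = u powr ((real p - 1) / (3 * real p + 1) - 2 * real p / (3 * real p + 1) * real 2)"
    by (simp only: theta_node_def lyap_weight_def u_def[symmetric] pw powr_diff)
  also have "\<dots> = u powr - 1"
    by (simp only: schedule_exponents(3)[of "real p"] of_nat_0_le_iff)
  finally show ?thesis using u by (simp add: u_def powr_minus_divide)
qed

lemma eta_p_sq_le:
  assumes "p \<ge> 2"
  shows "(eta_p p k)\<^sup>2 \<le> 1 / (real k + real p)"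
proof -
  define u where "u = real k + real p"
  have u: "u \<ge> 1" using assms by (simp add: u_def)
  have "(eta_p p k)\<^sup>2 = u powr (- ((2 * real p + 1) / (3 * real p + 1)) * 2)"
    using u by (simp add: eta_p_powr u_def[symmetric] powr_power)
  also have "\<dots> \<le> u powr (-1)" using u by (intro powr_mono) (auto simp: field_simps)
  finally show ?thesis using u by (simp add: u_def powr_minus_divide)
qed

lemma lyap_weight_Suc_ratio:
  assumes "p \<ge> 2"
  shows "lyap_weight p (Suc k) = lyap_weight p k * (1 + 1 / (real k + real p)) powr ((real p - 1) / (3 * real p + 1))"
proof -
  have "real (Suc k) + real p = (real k + real p) * (1 + 1 / (real k + real p))"
    using assms by (simp add: field_simps)
  then show ?thesis using assms by (simp only: lyap_weight_def) (subst powr_mult[symmetric], auto)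
qed

lemma lyap_weight_Suc_le:
  assumes "p \<ge> 2"
  shows "lyap_weight p (Suc k) \<le> 2 * lyap_weight p k"
proof -
  have "(1 + 1 / (real k + real p)) powr ((real p - 1) / (3 * real p + 1)) \<le> (1 + 1 / (real k + real p)) powr 1"
    using assms by (intro powr_mono) (auto simp: field_simps)
  also have "\<dots> \<le> 2" using assms by simp
  finally show ?thesis
    unfolding lyap_weight_Suc_ratio[OF assms] using lyap_weight_pos[OF assms, of k] by simp
qed

text \<open>The weight grows by \<open>(1 + 1 / u) powr s \<le> exp (s / u)\<close> with
  \<open>s \<le> 1 / 3\<close> and \<open>1 / u \<le> \<theta>\<close>. This consumes one third of
  the contraction and leaves two thirds.\<close>

lemma lyap_weight_contract:
  assumes p: "p \<ge> 2" and \<theta>: "1 / theta_node p k \<le> \<theta>" "\<theta> \<le> 1"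
  shows "lyap_weight p (Suc k) * (1 - \<theta>) \<le> lyap_weight p k * (1 - 2 / 3 * \<theta>)"
proof -
  define u where "u = real k + real p"
  have u: "u \<ge> 2" using p by (simp add: u_def)
  define s where "s = (real p - 1) / (3 * real p + 1)"
  have s: "0 \<le> s" "s \<le> 1 / 3" using p by (auto simp: s_def field_simps)
  have "theta_node p k \<le> u powr 1"
    unfolding theta_node_def u_def using p by (intro powr_mono) (auto simp: field_simps)
  then have "1 / u \<le> 1 / theta_node p k"
    using u theta_node_ge_1[OF p, of k] by (intro divide_left_mono) auto
  then have u\<theta>: "1 / u \<le> \<theta>" using \<theta> by linarith
  have "\<theta> > 0" using u\<theta> u by (smt (verit) divide_pos_pos)
  have su: "s / u \<le> \<theta> / 3"
    using mult_mono[OF s(2) u\<theta>] s u by simp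
  have "(1 + 1 / u) powr s = exp (s * ln (1 + 1 / u))" using u add_pos_pos[of 1 "1 / u"] by (simp add: powr_def)
  also have "\<dots> \<le> exp (s * (1 / u))" using u s by (simp only: exp_le_cancel_iff) (intro mult_left_mono ln_add_one_self_le_self, auto)
  also have "\<dots> \<le> exp (\<theta> / 3)" using su by simp
  finally have e: "(1 + 1 / u) powr s \<le> exp (\<theta> / 3)" .
  \<comment> \<open>The product on the right exceeds \<open>1 - \<theta>\<close> by
    \<open>2 / 9 * \<theta>^2\<close>; its first factor is there to cancel the exponential.\<close>
  have "exp (\<theta> / 3) * (1 - \<theta>) \<le> exp (\<theta> / 3) * ((1 - \<theta> / 3) * (1 - 2 / 3 * \<theta>))"
    by (intro mult_left_mono) (auto simp: algebra_simps)
  also have "\<dots> = (exp (\<theta> / 3) * (1 - \<theta> / 3)) * (1 - 2 / 3 * \<theta>)" by simp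
  also have "\<dots> \<le> 1 * (1 - 2 / 3 * \<theta>)"
  proof (rule mult_right_mono)
    have "1 - \<theta> / 3 \<le> exp (- (\<theta> / 3))" using exp_ge_add_one_self[of "- (\<theta> / 3)"] by simp
    then show "exp (\<theta> / 3) * (1 - \<theta> / 3) \<le> 1" by (simp add: exp_minus field_simps)
  qed (use \<theta> in auto)
  finally have "exp (\<theta> / 3) * (1 - \<theta>) \<le> 1 - 2 / 3 * \<theta>" by simp
  moreover have "(1 + 1 / u) powr s * (1 - \<theta>) \<le> exp (\<theta> / 3) * (1 - \<theta>)"
    by (intro mult_right_mono e) (use \<theta> in auto)
  ultimately have "(1 + 1 / u) powr s * (1 - \<theta>) \<le> 1 - 2 / 3 * \<theta>" by linarith
  then show ?thesis
    unfolding lyap_weight_Suc_ratio[OF p] u_def[symmetric] s_def[symmetric]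
    using lyap_weight_pos[OF p, of k] by (simp add: mult.assoc)
qed

lemma lyap_weight_0_le:
  assumes "p \<ge> 2"
  shows "lyap_weight p 0 \<le> real p"
proof -
  have "real p powr ((real p - 1) / (3 * real p + 1)) \<le> real p powr 1"
    using assms by (intro powr_mono) (auto simp: field_simps)
  then show ?thesis by (simp add: lyap_weight_def)
qed

text \<open>Comparison of a harmonic sum with the logarithm; \<open>K + 1 \<le> K^2\<close> for
  \<open>K \<ge> 2\<close> turns \<open>ln (K + 1)\<close> into \<open>2 * ln K\<close>.\<close>

lemma sum_inverse_shift_le:
  assumes "p \<ge> 2" "K \<ge> 2"
  shows "(\<Sum>k<K. 1 / (real k + real p)) \<le> 2 * ln (real K)"
proof -
  have "(\<Sum>k<K. 1 / (real k + real p)) \<le> (\<Sum>k<K. 1 / (real k + 2))"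
    using assms by (intro sum_mono divide_left_mono) auto
  also have "\<dots> \<le> ln (real K + 1)"
  proof (induction K)
    case (Suc K)
    have "1 / (real K + 2) \<le> ln (real K + 2) - ln (real K + 1)"
    proof -
      have "ln ((real K + 1) / (real K + 2)) \<le> (real K + 1) / (real K + 2) - 1"
        by (intro ln_le_minus_one) auto
      also have "\<dots> = - (1 / (real K + 2))" by (simp add: field_simps)
      finally show ?thesis by (simp add: ln_div)
    qed
    with Suc show ?case by (simp add: add.commute)
  qed simp
  also have "\<dots> \<le> ln ((real K)\<^sup>2)"
  proof -
    have "real K * 2 \<le> real K * real K" using assms by (intro mult_left_mono) auto
    then have "real K + 1 \<le> real K * real K" using assms by linarith
    then show ?thesis using assms by (subst ln_le_cancel_iff) (auto simp: power2_eq_square)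
  qed
  also have "\<dots> = 2 * ln (real K)" using assms by (simp add: ln_realpow)
  finally show ?thesis .
qed

text \<open>The tangent of \<open>ln\<close> at \<open>B\<close> gives
  \<open>ln y \<le> y / B + ln B\<close>, and the last hypothesis says
  \<open>ln B \<le> y / B\<close>.\<close>

lemma ln_over_le:
  fixes B y :: real
  assumes "B > 0" "y > 0" "y \<ge> B * ln B"
  shows "ln y / y \<le> 2 / B"
proof -
  have "ln (y / B) \<le> y / B - 1" using assms by (intro ln_le_minus_one) auto
  then have "ln y \<le> y / B + ln B" using assms by (simp add: ln_div)
  also have "ln B \<le> y / B" using assms by (simp add: field_simps)
  finally show ?thesis using assms by (simp add: field_simps)
qed

text \<open>In the variable \<open>y = K powr (p / (3 * p + 1))\<close> the threshold on
  \<open>K\<close> becomes \<open>y \<ge> B * ln B\<close>, and \<open>ln K\<close> is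
  \<open>(3 * p + 1) / p * ln y\<close>; \<open>B\<close> is such that the resulting bound
  \<open>2 / B\<close> reproduces \<open>\<epsilon>\<close> exactly.\<close>

lemma rate_le_epsilon:
  fixes M \<epsilon> :: real
  assumes p: "p \<ge> 2" and M: "M \<ge> 1" and \<epsilon>: "0 < \<epsilon>" "\<epsilon> < 1" and K: "K \<ge> 1"
    and KB: "real K \<ge> ((6 * real p + 2) * M / (real p * \<epsilon>) * ln ((6 * real p + 2) * M / (real p * \<epsilon>)))
              powr ((3 * real p + 1) / real p)"
  shows "M * ln (real K) / real K powr (real p / (3 * real p + 1)) \<le> \<epsilon>"
proof -
  define B where "B = (6 * real p + 2) * M / (real p * \<epsilon>)"
  define y where "y = real K powr (real p / (3 * real p + 1))"
  \<comment> \<open>\<open>B \<ge> 1\<close> is wanted so that \<open>B * ln B\<close> is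
    nonnegative and the reciprocal exponents cancel under \<open>powr\<close>.\<close>
  have "real p * \<epsilon> \<le> (6 * real p + 2) * M"
    using p \<epsilon> M by (intro mult_mono) auto
  then have B: "B \<ge> 1" using p \<epsilon> by (simp add: B_def)
  have y: "y > 0" using K by (simp add: y_def)
  have "B * ln B = ((B * ln B) powr ((3 * real p + 1) / real p)) powr (real p / (3 * real p + 1))"
    using B p by (simp add: powr_powr)
  also have "\<dots> \<le> y"
    unfolding y_def using KB by (intro powr_mono2) (auto simp: B_def)
  finally have "ln y / y \<le> 2 / B" using B y by (intro ln_over_le) auto
  moreover have "ln (real K) = (3 * real p + 1) / real p * ln y"
    using p K by (simp add: y_def ln_powr)
  ultimately have "M * ln (real K) / y \<le> M * ((3 * real p + 1) / real p) * (2 / B)"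
    using mult_left_mono[of "ln y / y" "2 / B" "M * ((3 * real p + 1) / real p)"] M p by (simp add: mult.assoc)
  also have "\<dots> = \<epsilon>"
  proof -
    have "B = 2 * (M * ((3 * real p + 1) / real p)) / \<epsilon>" using p \<epsilon> by (simp add: B_def field_simps)
    moreover have "M * ((3 * real p + 1) / real p) > 0" using M p by simp
    ultimately show ?thesis using \<epsilon> p M by simp
  qed
  finally show ?thesis by (simp add: y_def)
qed

text \<open>Telescoping of \<open>W k * b k\<close>. The contraction left after paying for the
  growth of \<open>W\<close> is what the sum on the left collects.\<close>

lemma weighted_recursion_sum:
  fixes b \<theta> W \<rho> :: "nat \<Rightarrow> real" and c :: real
  assumes step: "\<And>k. b (Suc k) \<le> (1 - \<theta> k) * b k + \<rho> k"
    and contract: "\<And>k. W (Suc k) * (1 - \<theta> k) \<le> W k * (1 - c * \<theta> k)"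
    and nonneg: "\<And>k. b k \<ge> 0" "\<And>k. W k \<ge> 0"
  shows "W K * b K + (\<Sum>k<K. c * W k * \<theta> k * b k) \<le> W 0 * b 0 + (\<Sum>k<K. W (Suc k) * \<rho> k)"

proof (induction K)
  case (Suc K)
  have "W (Suc K) * b (Suc K) \<le> W (Suc K) * ((1 - \<theta> K) * b K + \<rho> K)"
    using step nonneg by (intro mult_left_mono) auto
  also have "\<dots> = W (Suc K) * (1 - \<theta> K) * b K + W (Suc K) * \<rho> K" by (simp add: algebra_simps)
  also have "\<dots> \<le> W K * (1 - c * \<theta> K) * b K + W (Suc K) * \<rho> K"
    using contract nonneg by (intro add_right_mono mult_right_mono) auto
  finally show ?case using Suc by (simp add: algebra_simps)
qed simp

section \<open>The momentum error\<close>

text \<open>One iteration with the sample as an argument of its own, so that it can be integrated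
  out while the state is held fixed.\<close>

definition sfom_step where
  "sfom_step G eta q gam th k s e =
     (let (x, xp, m) = s;
          g = (if k = 0 then (\<lambda>t. 1) else gam (k - 1));
          w = (if k = 0 then (\<lambda>t. 1 / real q) else th (k - 1));
          z = (\<lambda>t. x + ((1 - g t) / g t) *\<^sub>R (x - xp));
          m' = (1 - (\<Sum>t\<in>{1..q}. w t)) *\<^sub>R m + (\<Sum>t\<in>{1..q}. w t *\<^sub>R G (z t) e)
      in (x - (eta k / norm m') *\<^sub>R m', x, m'))"

lemma sfom_state_Suc:
  "sfom_state G x0 eta q gam th xi (Suc k) = sfom_step G eta q gam th k (sfom_state G x0 eta q gam th xi k) (xi k)"
  by (simp add: sfom_step_def Let_def case_prod_beta)

section \<open>Dependence of the state on the samples\<close>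

lemma sfom_state_cong:
  assumes "\<And>i. i < k \<Longrightarrow> xi i = xi' i"
  shows "sfom_state G x0 eta q gam th xi k = sfom_state G x0 eta q gam th xi' k"
  using assms
proof (induction k)
  case (Suc k)
  then show ?case by (simp add: sfom_state_Suc del: sfom_state.simps)
qed simp

lemma sfom_step_measurable:
  fixes G :: "'a::euclidean_space \<Rightarrow> 'b \<Rightarrow> 'a"
  assumes G: "(\<lambda>(x, e). G x e) \<in> borel_measurable (borel \<Otimes>\<^sub>M P)"
    and S [measurable]: "S \<in> borel_measurable N" and E [measurable]: "E \<in> measurable N P"
  shows "(\<lambda>\<omega>. sfom_step G eta q gam th k (S \<omega>) (E \<omega>)) \<in> borel_measurable N"
proof -
  have 1 [measurable]: "(\<lambda>\<omega>. fst (S \<omega>)) \<in> borel_measurable N"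
    by (rule measurable_compose[OF S borel_measurable_continuous_onI]) (intro continuous_intros)
  have 2 [measurable]: "(\<lambda>\<omega>. fst (snd (S \<omega>))) \<in> borel_measurable N"
    by (rule measurable_compose[OF S borel_measurable_continuous_onI]) (intro continuous_intros)
  have 3 [measurable]: "(\<lambda>\<omega>. snd (snd (S \<omega>))) \<in> borel_measurable N"
    by (rule measurable_compose[OF S borel_measurable_continuous_onI]) (intro continuous_intros)
  have G' [measurable]: "(\<lambda>\<omega>. G (X \<omega>) (E \<omega>)) \<in> borel_measurable N" if [measurable]: "X \<in> borel_measurable N" for X
    using measurable_compose[OF measurable_Pair[OF that E] G] by simp
  show ?thesis
    unfolding sfom_step_def Let_def case_prod_beta by (intro borel_measurable_Pair) measurable
qed

lemma sfom_state_measurable: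
  fixes G :: "'a::euclidean_space \<Rightarrow> 'b \<Rightarrow> 'a"
  assumes G: "(\<lambda>(x, e). G x e) \<in> borel_measurable (borel \<Otimes>\<^sub>M P)"
    and xis: "\<And>i. i < k \<Longrightarrow> (\<lambda>\<omega>. xis \<omega> i) \<in> measurable N P"
  shows "(\<lambda>\<omega>. sfom_state G x0 eta q gam th (xis \<omega>) k) \<in> borel_measurable N"
  using xis
proof (induction k)
  case (Suc k)
  then show ?case unfolding sfom_state_Suc by (intro sfom_step_measurable[OF G]) auto
qed simp

text \<open>The state after \<open>k\<close> iterations is a function of the samples with index
  below \<open>k\<close>, hence independent of sample \<open>k\<close>. Integrating that sample with
  the state frozen plays the part of a conditional expectation.\<close>

lemma (in prob_space) nn_integral_sfom_state:
  fixes G :: "'s::euclidean_space \<Rightarrow> 'b \<Rightarrow> 's" and x0 eta q gam th and k :: nat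
  assumes G: "(\<lambda>(x, e). G x e) \<in> borel_measurable (borel \<Otimes>\<^sub>M P)"
    and ind: "indep_vars (\<lambda>_. P) xis UNIV"
    and h: "h \<in> borel_measurable (borel \<Otimes>\<^sub>M P)"
  defines "st \<equiv> \<lambda>\<omega>. sfom_state G x0 eta q gam th (\<lambda>k. xis k \<omega>) k"
  shows "(\<integral>\<^sup>+ \<omega>. h (st \<omega>, xis k \<omega>) \<partial>M) = (\<integral>\<^sup>+ \<omega>. (\<integral>\<^sup>+ e. h (st \<omega>, e) \<partial>distr M P (xis k)) \<partial>M)"
proof -
  let ?past = "\<lambda>\<omega>. restrict (\<lambda>i. xis i \<omega>) {..<k}" and ?present = "\<lambda>\<omega>. restrict (\<lambda>i. xis i \<omega>) {k}"
  have st: "st \<omega> = sfom_state G x0 eta q gam th (?past \<omega>) k" for \<omega>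
    unfolding st_def by (intro sfom_state_cong) simp
  have 1: "indep_var (PiM {..<k} (\<lambda>_. P)) ?past (PiM {k} (\<lambda>_. P)) ?present"
    by (rule indep_var_restrict[OF ind]) auto
  have 2: "(\<lambda>w. sfom_state G x0 eta q gam th w k) \<in> borel_measurable (PiM {..<k} (\<lambda>_. P))"
    by (rule sfom_state_measurable[OF G]) auto
  have 3: "(\<lambda>w. w k) \<in> measurable (PiM {k} (\<lambda>_. P)) P" by simp
  show ?thesis
    using nn_integral_indep_compose[OF 1 2 3 h] by (simp add: st[symmetric])
qed

text \<open>Only an inequality, since a zero momentum leaves the point where it is.\<close>

lemma sfom_step_displacement:
  "norm (fst (sfom_step G eta q gam th k s e) - fst (snd (sfom_step G eta q gam th k s e))) \<le> \<bar>eta k\<bar>"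
  by (simp add: sfom_step_def Let_def case_prod_beta)

lemma sfom_state_displacement:
  assumes "\<And>k. eta k \<ge> 0"
  shows "norm (fst (sfom_state G x0 eta q gam th xi (Suc k)) - fst (snd (sfom_state G x0 eta q gam th xi (Suc k)))) \<le> eta k"
  using sfom_step_displacement[of G eta q gam th k] assms[of k] by (simp add: sfom_state_Suc del: sfom_state.simps)

text \<open>On the state after \<open>k + 1\<close> iterations this is the error of \<open>m\<^sup>k\<close> at \<open>x\<^sup>k\<close>.\<close>
definition momentum_error :: "('a \<Rightarrow> 'a) \<Rightarrow> 'a \<times> 'a \<times> 'a::real_normed_vector \<Rightarrow> real" where
  "momentum_error g s = norm (snd (snd s) - g (fst (snd s)))"

lemma momentum_error_measurable:
  fixes g :: "'a::euclidean_space \<Rightarrow> 'a"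
  assumes "continuous_on UNIV g"
  shows "momentum_error g \<in> borel_measurable borel"
  unfolding momentum_error_def
  by (intro borel_measurable_continuous_onI continuous_intros continuous_on_compose2[OF assms]) auto

locale smooth_oracle = P: prob_space P for P :: "'b measure" +
  fixes f :: "'a::euclidean_space \<Rightarrow> real" and g :: "'a \<Rightarrow> 'a" and G :: "'a \<Rightarrow> 'b \<Rightarrow> 'a"
    and D :: "nat \<Rightarrow> 'a \<Rightarrow> 'a list \<Rightarrow> real" and L \<sigma> Lp :: real and p :: nat
  assumes grad: "\<And>x. (f has_derivative (\<lambda>h. g x \<bullet> h)) (at x)"
    and Lip: "\<And>x y. norm (g y - g x) \<le> L * norm (y - x)" and L: "L \<ge> 0"
    and G_meas: "(\<lambda>(x, e). G x e) \<in> borel_measurable (borel \<Otimes>\<^sub>M P)"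
    and unbiased: "\<And>x. has_bochner_integral P (G x) (g x)"
    and var: "\<And>x. (\<integral>\<^sup>+ e. ennreal ((norm (G x e - g x))\<^sup>2) \<partial>P) \<le> ennreal (\<sigma>\<^sup>2)"
    and p: "p \<ge> 2" and derivs: "has_derivs_upto p f D"
    and Lip_p: "\<And>x y. multilin_norm p (\<lambda>hs. D p y hs - D p x hs) \<le> Lp * norm (y - x)" and Lp: "Lp \<ge> 0"
begin

lemma continuous_gradient: "continuous_on UNIV g"
proof -
  have "L-lipschitz_on UNIV g" using Lip L by (intro lipschitz_onI) (auto simp: dist_norm)
  then show ?thesis by (rule lipschitz_on_continuous_on)
qed

text \<open>The next error splits into \<open>(1 - \<theta>) *\<^sub>R (m - g xp)\<close>, the
  extrapolation bias \<open>r\<close> and mean-zero noise. The noise adds its second moment; the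
  bias is merged by convexity at the price \<open>R^2 / \<theta>\<close>. Step \<open>Suc k\<close>
  reads the parameters of index \<open>k\<close>.\<close>

lemma step_momentum_error:
  assumes disp: "norm (x - xp) \<le> \<delta>" and gam: "\<And>t. t \<in> {1..q} \<Longrightarrow> gam k t > 0"
    and mom: "\<And>r. 1 \<le> r \<Longrightarrow> r < p \<Longrightarrow> (\<Sum>t\<in>{1..q}. th k t * (1 / gam k t) ^ r) = 1"
    and \<theta>: "\<theta> = (\<Sum>t\<in>{1..q}. th k t)" "0 < \<theta>" "\<theta> \<le> 1"
    and R: "Lp / fact (p-1) * \<delta> ^ p * (1 + (\<Sum>t\<in>{1..q}. \<bar>th k t\<bar> * (1 / gam k t) ^ p)) \<le> R"
  shows "(\<integral>\<^sup>+ e. ennreal ((momentum_error g (sfom_step G eta q gam th (Suc k) (x, xp, m) e))\<^sup>2) \<partial>P)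
    \<le> ennreal ((1 - \<theta>) * (momentum_error g (x, xp, m))\<^sup>2 + (R\<^sup>2 / \<theta> + (\<Sum>t\<in>{1..q}. \<bar>th k t\<bar>)\<^sup>2 * \<sigma>\<^sup>2))"
proof -
  define w where "w = th k"
  define u where "u = (\<lambda>t. 1 / gam k t)"
  \<comment> \<open>Rebased at \<open>xp\<close>, the extrapolated points have the form treated in
    \<open>extrapolated_gradient_error\<close>, with \<open>y = x\<close> and nodes
    \<open>1 / gam k t\<close>.\<close>
  define z where "z = (\<lambda>t. xp + u t *\<^sub>R (x - xp))"
  have z: "x + ((1 - gam k t) / gam k t) *\<^sub>R (x - xp) = z t" if "t \<in> {1..q}" for t
  proof -
    have "(1 - gam k t) / gam k t = u t - 1" using gam[OF that] by (simp add: u_def diff_divide_distrib)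
    show ?thesis unfolding \<open>(1 - gam k t) / gam k t = u t - 1\<close> by (simp add: z_def algebra_simps)
  qed
  \<comment> \<open>The part of the new error free of the sample. The new momentum is compared with
    \<open>g x\<close>, because \<open>x\<close> becomes the previous point.\<close>
  define b where "b = (1 - \<theta>) *\<^sub>R m - g x"
  have "snd (sfom_step G eta q gam th (Suc k) (x, xp, m) e) = (x, (1 - \<theta>) *\<^sub>R m + (\<Sum>t\<in>{1..q}. w t *\<^sub>R G (z t) e))" for e
    using z by (auto simp: sfom_step_def Let_def \<theta>(1) w_def intro!: sum.cong)
  then have err: "momentum_error g (sfom_step G eta q gam th (Suc k) (x, xp, m) e) = norm (b + (\<Sum>t\<in>{1..q}. w t *\<^sub>R G (z t) e))" for e
    by (simp add: momentum_error_def b_def algebra_simps)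
  define r where "r = (1 - \<theta>) *\<^sub>R g xp + (\<Sum>t\<in>{1..q}. w t *\<^sub>R g (z t)) - g x"
  have "norm r \<le> Lp / fact (p-1) * norm (x - xp) ^ p * (1 + (\<Sum>t\<in>{1..q}. \<bar>w t\<bar> * u t ^ p))"
    unfolding r_def z_def \<theta>(1) w_def[symmetric]
    by (rule extrapolated_gradient_error[OF grad derivs p Lip_p Lp])
       (use gam mom in \<open>auto simp: u_def w_def less_imp_le\<close>)
  also have "\<dots> \<le> Lp / fact (p-1) * \<delta> ^ p * (1 + (\<Sum>t\<in>{1..q}. \<bar>w t\<bar> * u t ^ p))"
  proof (intro mult_right_mono mult_left_mono power_mono)
    show "0 \<le> 1 + (\<Sum>t\<in>{1..q}. \<bar>w t\<bar> * u t ^ p)"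
      using gam by (intro add_nonneg_nonneg sum_nonneg) (auto simp: u_def less_imp_le)
  qed (use disp Lp in auto)
  also have "\<dots> \<le> R" using R by (simp add: u_def w_def)
  finally have r: "norm r \<le> R" .
  have "b + (\<Sum>t\<in>{1..q}. w t *\<^sub>R g (z t)) = (1 - \<theta>) *\<^sub>R (m - g xp) + r"
    by (simp add: b_def r_def algebra_simps)
  then have "(norm (b + (\<Sum>t\<in>{1..q}. w t *\<^sub>R g (z t))))\<^sup>2 \<le> (1 - \<theta>) * (norm (m - g xp))\<^sup>2 + R\<^sup>2 / \<theta>"
    using norm_add_sq_contract[OF \<theta>(2,3) r] by simp
  then have le: "(norm (b + (\<Sum>t\<in>{1..q}. w t *\<^sub>R g (z t))))\<^sup>2 + (\<Sum>t\<in>{1..q}. \<bar>w t\<bar>)\<^sup>2 * \<sigma>\<^sup>2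
      \<le> (1 - \<theta>) * (momentum_error g (x, xp, m))\<^sup>2 + (R\<^sup>2 / \<theta> + (\<Sum>t\<in>{1..q}. \<bar>w t\<bar>)\<^sup>2 * \<sigma>\<^sup>2)"
    by (simp add: momentum_error_def)
  have "(\<integral>\<^sup>+ e. ennreal ((norm (b + (\<Sum>t\<in>{1..q}. w t *\<^sub>R G (z t) e)))\<^sup>2) \<partial>P)
    \<le> ennreal ((norm (b + (\<Sum>t\<in>{1..q}. w t *\<^sub>R g (z t))))\<^sup>2 + (\<Sum>t\<in>{1..q}. \<bar>w t\<bar>)\<^sup>2 * \<sigma>\<^sup>2)"
    by (rule P.second_moment_weighted_sum) (use unbiased var in auto)
  from order_trans[OF this ennreal_leI[OF le]] show ?thesis
    unfolding err w_def[symmetric] .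
qed

text \<open>The first summand is the squared bias over the contraction rate, whose reciprocal is at
  most \<open>theta_node p k\<close>; the second is the sampling variance.\<close>

definition noise_bound :: "nat \<Rightarrow> real" where
  "noise_bound k = (Lp * real p ^ p * (eta_p p k ^ p * theta_node p k ^ (p-1)))\<^sup>2 * theta_node p k
     + (fact p / theta_node p k)\<^sup>2 * \<sigma>\<^sup>2"

abbreviation theta_sum :: "nat \<Rightarrow> real" where
  "theta_sum k \<equiv> \<Sum>t\<in>{1..p-1}. theta_p p k t"

lemma theta_sum_pos: "theta_sum k > 0"
  using sum_theta_p_bounds(1)[OF p, of k] theta_node_ge_1[OF p, of k] by (smt (verit) divide_pos_pos)

lemma eta_p_nonneg: "eta_p p k \<ge> 0" by (simp add: eta_p_def)

text \<open>The state entering step \<open>Suc k\<close> was produced with step size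
  \<open>eta_p p k\<close>, whence the index in the hypothesis.\<close>

lemma step_p_momentum_error:
  assumes disp: "norm (fst s - fst (snd s)) \<le> eta_p p k"
  shows "(\<integral>\<^sup>+ e. ennreal ((momentum_error g (sfom_step G (eta_p p) (p-1) (gamma_p p) (theta_p p) (Suc k) s e))\<^sup>2) \<partial>P)
    \<le> ennreal ((1 - theta_sum k) * (momentum_error g s)\<^sup>2 + noise_bound k)"
proof -
  obtain x xp m where s: "s = (x, xp, m)" by (cases s)
  define a where "a = theta_node p k"
  have a: "a \<ge> 1" unfolding a_def by (rule theta_node_ge_1[OF p])
  have gam: "gamma_p p k t > 0" if "t \<in> {1..p-1}" for t
    using that a by (simp add: gamma_p_eq a_def)
  define R where "R = Lp * real p ^ p * (eta_p p k ^ p * theta_node p k ^ (p-1))"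
  have R: "Lp / fact (p-1) * eta_p p k ^ p * (1 + (\<Sum>t\<in>{1..p-1}. \<bar>theta_p p k t\<bar> * (1 / gamma_p p k t) ^ p)) \<le> R"
    using mult_left_mono[OF sum_abs_theta_p_power_le[OF p, of k], of "Lp * eta_p p k ^ p"] Lp eta_p_nonneg[of k]
    by (simp add: R_def mult_ac)
  have le: "R\<^sup>2 / theta_sum k + (\<Sum>t\<in>{1..p-1}. \<bar>theta_p p k t\<bar>)\<^sup>2 * \<sigma>\<^sup>2 \<le> noise_bound k"
    unfolding noise_bound_def R_def[symmetric]
  proof (intro add_mono mult_right_mono power_mono sum_abs_theta_p_le[OF p])
    have "1 / theta_sum k \<le> a"
      using sum_theta_p_bounds(1)[OF p, of k] theta_sum_pos[of k] a by (simp add: a_def field_simps)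
    from mult_left_mono[OF this, of "R\<^sup>2"] show "R\<^sup>2 / theta_sum k \<le> R\<^sup>2 * theta_node p k" by (simp add: a_def)
  qed (auto simp: sum_nonneg)
  have "(\<integral>\<^sup>+ e. ennreal ((momentum_error g (sfom_step G (eta_p p) (p-1) (gamma_p p) (theta_p p) (Suc k) s e))\<^sup>2) \<partial>P)
    \<le> ennreal ((1 - theta_sum k) * (momentum_error g s)\<^sup>2 + (R\<^sup>2 / theta_sum k + (\<Sum>t\<in>{1..p-1}. \<bar>theta_p p k t\<bar>)\<^sup>2 * \<sigma>\<^sup>2))"
    unfolding s using disp s
    by (intro step_momentum_error[where \<delta> = "eta_p p k"] gam theta_p_moment[OF p] refl theta_sum_pos sum_theta_p_bounds(2)[OF p] R) auto
  also have "\<dots> \<le> ennreal ((1 - theta_sum k) * (momentum_error g s)\<^sup>2 + noise_bound k)"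
    using le by (intro ennreal_leI) auto
  finally show ?thesis .
qed

text \<open>Step 0 runs with \<open>\<gamma> = 1\<close> and weights \<open>1 / (p - 1)\<close>
  summing to 1, so the momentum is the single sample \<open>G x0 e\<close> and the error is its
  noise.\<close>

lemma initial_momentum_error:
  "(\<integral>\<^sup>+ e. ennreal ((momentum_error g (sfom_step G eta (p-1) gam th 0 (x0, x0, 0) e))\<^sup>2) \<partial>P) \<le> ennreal (\<sigma>\<^sup>2)"
proof -
  have "(\<Sum>t\<in>{1..p-1}. (1 / real (p-1)) *\<^sub>R v) = v" for v :: 'a
    using p by (simp add: scaleR_left.sum[symmetric] del: scaleR_left.sum)
  then have "momentum_error g (sfom_step G eta (p-1) gam th 0 (x0, x0, 0) e) = norm (G x0 e - g x0)" for e
    using p by (simp add: momentum_error_def sfom_step_def Let_def)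
  then show ?thesis using var[of x0] by simp
qed

text \<open>A deterministic majorant for the expected squared error of \<open>m^k\<close>, that is,
  of the state after \<open>k + 1\<close> iterations.\<close>

fun error_bound :: "nat \<Rightarrow> real" where
  "error_bound 0 = \<sigma>\<^sup>2"
| "error_bound (Suc k) = (1 - theta_sum k) * error_bound k + noise_bound k"

lemma noise_bound_nonneg: "noise_bound k \<ge> 0"
  using theta_node_ge_1[OF p, of k] by (simp add: noise_bound_def)

lemma error_bound_nonneg: "error_bound k \<ge> 0"
proof (induction k)
  case (Suc k)
  then show ?case using noise_bound_nonneg[of k] sum_theta_p_bounds(2)[OF p, of k] by simp
qed simp

text \<open>Passing from the weight at \<open>Suc k\<close> to the one at \<open>k\<close> costs the
  factor 2; bias and variance then both become multiples of \<open>1 / (k + p)\<close>.\<close>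

lemma lyap_noise_bound:
  "lyap_weight p (Suc k) * noise_bound k \<le> (2 * (real p ^ (2 * p) * Lp\<^sup>2) + 2 * ((fact p)\<^sup>2 * \<sigma>\<^sup>2)) * (1 / (real k + real p))"
proof -
  have "lyap_weight p (Suc k) * noise_bound k \<le> 2 * lyap_weight p k * noise_bound k"
    by (intro mult_right_mono lyap_weight_Suc_le[OF p] noise_bound_nonneg)
  also have "\<dots> = 2 * (Lp * real p ^ p)\<^sup>2 * (lyap_weight p k * ((eta_p p k ^ p * theta_node p k ^ (p-1))\<^sup>2 * theta_node p k))
      + 2 * ((fact p)\<^sup>2 * \<sigma>\<^sup>2) * (lyap_weight p k / (theta_node p k)\<^sup>2)"
    by (simp add: noise_bound_def power_mult_distrib power_divide algebra_simps)
  also have "\<dots> = (2 * (real p ^ (2 * p) * Lp\<^sup>2) + 2 * ((fact p)\<^sup>2 * \<sigma>\<^sup>2)) * (1 / (real k + real p))"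
    unfolding lyap_weight_bias[OF p] lyap_weight_variance[OF p]
    by (simp add: power_mult_distrib power_mult[symmetric] mult.commute[of p] distrib_right add_divide_distrib)
  finally show ?thesis .
qed

text \<open>\<open>weighted_recursion_sum\<close> with \<open>c = 2 / 3\<close> from
  \<open>lyap_weight_contract\<close>; the final Lyapunov term is dropped and the initial one is at
  most \<open>p * \<sigma>^2\<close>.\<close>

lemma sum_eta_error_bound:
  "(\<Sum>k<K. 2 / 3 * (lyap_weight p k * theta_sum k * error_bound k))
    \<le> real p * \<sigma>\<^sup>2 + (2 * (real p ^ (2 * p) * Lp\<^sup>2) + 2 * ((fact p)\<^sup>2 * \<sigma>\<^sup>2)) * (\<Sum>k<K. 1 / (real k + real p))"
proof -
  have "lyap_weight p K * error_bound K + (\<Sum>k<K. 2 / 3 * lyap_weight p k * theta_sum k * error_bound k)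
      \<le> lyap_weight p 0 * error_bound 0 + (\<Sum>k<K. lyap_weight p (Suc k) * noise_bound k)"
    by (intro weighted_recursion_sum lyap_weight_contract[OF p] sum_theta_p_bounds[OF p]
        error_bound_nonneg less_imp_le[OF lyap_weight_pos[OF p]]) simp
  moreover have "lyap_weight p 0 * error_bound 0 \<le> real p * \<sigma>\<^sup>2"
    using mult_right_mono[OF lyap_weight_0_le[OF p], of "\<sigma>\<^sup>2"] by simp
  moreover have "(\<Sum>k<K. lyap_weight p (Suc k) * noise_bound k)
      \<le> (2 * (real p ^ (2 * p) * Lp\<^sup>2) + 2 * ((fact p)\<^sup>2 * \<sigma>\<^sup>2)) * (\<Sum>k<K. 1 / (real k + real p))"
    unfolding sum_distrib_left by (intro sum_mono lyap_noise_bound)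
  moreover have "0 \<le> lyap_weight p K * error_bound K"
    by (intro mult_nonneg_nonneg error_bound_nonneg less_imp_le[OF lyap_weight_pos[OF p]])
  ultimately show ?thesis by (simp only: mult.assoc)
qed

text \<open>Young's inequality, scaled so that the quadratic term matches the summands in
  \<open>sum_eta_error_bound\<close>.\<close>

lemma young_eta:
  "2 * eta_p p k * y \<le> 2 / 3 * (lyap_weight p k * theta_sum k * y\<^sup>2) + 3 / 2 * (1 / (real k + real p))"
proof -
  define c where "c = lyap_weight p k * theta_sum k"
  have c: "c > 0" unfolding c_def by (intro mult_pos_pos lyap_weight_pos[OF p] theta_sum_pos)
  have u: "real k + real p > 0" using p by simp
  have a: "theta_node p k \<ge> 1" by (rule theta_node_ge_1[OF p])
  have "(eta_p p k)\<^sup>2 = (lyap_weight p k / theta_node p k) * (1 / (real k + real p))"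
    using arg_cong[OF eta_p_sq_node[OF p, of k], of "\<lambda>v. v / theta_node p k"] a by (simp add: mult.commute)
  also have "\<dots> \<le> c * (1 / (real k + real p))"
    unfolding c_def using mult_left_mono[OF sum_theta_p_bounds(1)[OF p, of k], of "lyap_weight p k"] lyap_weight_pos[OF p, of k] u
    by (intro mult_right_mono) auto
  finally have e: "(eta_p p k)\<^sup>2 / c \<le> 1 / (real k + real p)" using c by (simp add: divide_le_eq mult.commute)
  \<comment> \<open>Completing the square in \<open>y\<close>; the subtracted square is then
    dropped.\<close>
  have "2 * eta_p p k * y = 2 / 3 * (c * y\<^sup>2) + 3 / 2 * ((eta_p p k)\<^sup>2 / c) - 2 / 3 * c * (y - 3 / 2 * (eta_p p k / c))\<^sup>2"
    using c by (simp add: field_simps power2_eq_square)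
  also have "\<dots> \<le> 2 / 3 * (c * y\<^sup>2) + 3 / 2 * ((eta_p p k)\<^sup>2 / c)" using c by simp
  also have "\<dots> \<le> 2 / 3 * (c * y\<^sup>2) + 3 / 2 * (1 / (real k + real p))"
    using e by (intro add_left_mono mult_left_mono) auto
  finally show ?thesis by (simp only: c_def)
qed

text \<open>The descent inequality summed along a single sample path, with the term linear in the
  momentum error split by \<open>young_eta\<close>.\<close>

lemma sum_gradient_pathwise:
  fixes x0 :: 'a and xi :: "nat \<Rightarrow> 'b" and K :: nat
  defines "st \<equiv> sfom_state G x0 (eta_p p) (p-1) (gamma_p p) (theta_p p) xi"
  assumes low: "\<And>x. f x \<ge> flow"
  shows "(\<Sum>k<K. eta_p p k * norm (g (fst (st k))))
    \<le> f x0 - flow + (L / 2 + 3 / 2) * (\<Sum>k<K. 1 / (real k + real p))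
      + (\<Sum>k<K. 2 / 3 * (lyap_weight p k * theta_sum k * (momentum_error g (st (Suc k)))\<^sup>2))"
proof -
  have "f (fst (st K)) + (\<Sum>k<K. eta_p p k * norm (g (fst (st k))))
    \<le> f x0 + (\<Sum>k<K. (L / 2 + 3 / 2) * (1 / (real k + real p))
        + 2 / 3 * (lyap_weight p k * theta_sum k * (momentum_error g (st (Suc k)))\<^sup>2))" for K
  proof (induction K)
    case 0
    show ?case by (simp add: st_def)
  next
    case (Suc K)
    \<comment> \<open>This state holds \<open>x^(K+1)\<close>, \<open>x^K\<close> and
      \<open>m^K\<close>, everything that descent step \<open>K\<close> involves.\<close>
    obtain x' x m where s: "st (Suc K) = (x', x, m)" by (cases "st (Suc K)")
    have x: "x = fst (st K)" and x': "x' = x - (eta_p p K / norm m) *\<^sub>R m"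
      using s unfolding st_def sfom_state_Suc by (auto simp: sfom_step_def Let_def case_prod_beta)
    have "f x' + eta_p p K * norm (g x) \<le> f x + 2 * eta_p p K * norm (m - g x) + L / 2 * (eta_p p K)\<^sup>2"
      unfolding x' by (rule normalized_step_descent[OF grad Lip L eta_p_nonneg])
    also have "\<dots> \<le> f x + (2 / 3 * (lyap_weight p K * theta_sum K * (norm (m - g x))\<^sup>2) + 3 / 2 * (1 / (real K + real p)))
        + L / 2 * (1 / (real K + real p))"
      by (intro add_mono order_refl young_eta mult_left_mono eta_p_sq_le[OF p]) (use L in auto)
    finally have "f x' + eta_p p K * norm (g x) \<le> f x + ((L / 2 + 3 / 2) * (1 / (real K + real p))
        + 2 / 3 * (lyap_weight p K * theta_sum K * (norm (m - g x))\<^sup>2))" by (simp only: distrib_right)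
    moreover have "fst (st (Suc K)) = x'" "fst (st K) = x" "momentum_error g (st (Suc K)) = norm (m - g x)"
      using s x by (simp_all add: momentum_error_def)
    ultimately show ?case using Suc by (simp only: sum.lessThan_Suc)
  qed
  from this[of K] low[of "fst (st K)"] show ?thesis
    by (simp add: sum.distrib sum_distrib_left)
qed

section \<open>Expectations over the sample sequence\<close>

context
  fixes M :: "'c measure" and xis :: "nat \<Rightarrow> 'c \<Rightarrow> 'b" and x0 :: 'a
  assumes M: "prob_space M" and xis [measurable]: "\<And>k. xis k \<in> measurable M P"
    and ind: "prob_space.indep_vars M (\<lambda>_. P) xis UNIV" and distr: "\<And>k. distr M P (xis k) = P"
begin

interpretation M: prob_space M by (rule M)

abbreviation st :: "nat \<Rightarrow> 'c \<Rightarrow> 'a \<times> 'a \<times> 'a" where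
  "st k \<omega> \<equiv> sfom_state G x0 (eta_p p) (p-1) (gamma_p p) (theta_p p) (\<lambda>k. xis k \<omega>) k"

lemma st_measurable [measurable]: "st k \<in> borel_measurable M"
  by (rule sfom_state_measurable[OF G_meas]) simp

lemma momentum_error_st_measurable [measurable]: "(\<lambda>\<omega>. momentum_error g (st k \<omega>)) \<in> borel_measurable M"
  by (rule measurable_compose[OF st_measurable momentum_error_measurable[OF continuous_gradient]])

lemma nn_integral_step:
  "(\<integral>\<^sup>+ \<omega>. ennreal ((momentum_error g (st (Suc k) \<omega>))\<^sup>2) \<partial>M) =
    (\<integral>\<^sup>+ \<omega>. (\<integral>\<^sup>+ e. ennreal ((momentum_error g (sfom_step G (eta_p p) (p-1) (gamma_p p) (theta_p p) k (st k \<omega>) e))\<^sup>2) \<partial>P) \<partial>M)"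
proof -
  have "(\<lambda>z. sfom_step G (eta_p p) (p-1) (gamma_p p) (theta_p p) k (fst z) (snd z)) \<in> borel_measurable (borel \<Otimes>\<^sub>M P)"
    by (intro sfom_step_measurable[OF G_meas]) auto
  from measurable_compose[OF this momentum_error_measurable[OF continuous_gradient]]
  have "(\<lambda>z. ennreal ((momentum_error g (sfom_step G (eta_p p) (p-1) (gamma_p p) (theta_p p) k (fst z) (snd z)))\<^sup>2))
      \<in> borel_measurable (borel \<Otimes>\<^sub>M P)" by measurable
  from M.nn_integral_sfom_state[OF G_meas ind this] show ?thesis
    by (simp add: sfom_state_Suc distr del: sfom_state.simps)
qed

text \<open>Averaging the one-step bound reproduces the recursion of \<open>error_bound\<close>; the
  displacement hypothesis holds on every path, so the bound applies pointwise.\<close>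

lemma expected_error_le: "(\<integral>\<^sup>+ \<omega>. ennreal ((momentum_error g (st (Suc k) \<omega>))\<^sup>2) \<partial>M) \<le> ennreal (error_bound k)"
proof (induction k)
  case 0
  have "(\<integral>\<^sup>+ \<omega>. ennreal ((momentum_error g (st (Suc 0) \<omega>))\<^sup>2) \<partial>M) \<le> (\<integral>\<^sup>+ \<omega>. ennreal (\<sigma>\<^sup>2) \<partial>M)"
    unfolding nn_integral_step by (intro nn_integral_mono) (simp add: initial_momentum_error[simplified])
  then show ?case by (simp add: M.emeasure_space_1)
next
  case (Suc k)
  have \<theta>: "0 \<le> 1 - theta_sum k" using sum_theta_p_bounds(2)[OF p, of k] by simp
  define V where "V = (\<lambda>\<omega>. (momentum_error g (st (Suc k) \<omega>))\<^sup>2)"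
  have V [measurable]: "V \<in> borel_measurable M" unfolding V_def by measurable
  have "(\<integral>\<^sup>+ \<omega>. ennreal ((momentum_error g (st (Suc (Suc k)) \<omega>))\<^sup>2) \<partial>M)
      \<le> (\<integral>\<^sup>+ \<omega>. ennreal ((1 - theta_sum k) * V \<omega> + noise_bound k) \<partial>M)"
    unfolding nn_integral_step[of "Suc k"] V_def
    by (intro nn_integral_mono step_p_momentum_error sfom_state_displacement eta_p_nonneg)
  also have "\<dots> = (\<integral>\<^sup>+ \<omega>. ennreal (1 - theta_sum k) * ennreal (V \<omega>) + ennreal (noise_bound k) \<partial>M)"
    using \<theta> noise_bound_nonneg by (simp add: V_def ennreal_plus ennreal_mult del: sfom_state.simps)
  also have "\<dots> = ennreal (1 - theta_sum k) * (\<integral>\<^sup>+ \<omega>. ennreal (V \<omega>) \<partial>M) + ennreal (noise_bound k)"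
    by (simp add: nn_integral_add nn_integral_cmult M.emeasure_space_1)
  also have "\<dots> \<le> ennreal (1 - theta_sum k) * ennreal (error_bound k) + ennreal (noise_bound k)"
    using Suc unfolding V_def by (intro add_right_mono mult_left_mono) auto
  also have "\<dots> = ennreal (error_bound (Suc k))"
    using \<theta> noise_bound_nonneg error_bound_nonneg[of k] by (simp add: ennreal_plus ennreal_mult)
  finally show ?case .
qed

text \<open>On the right of the pathwise bound only the squared errors are random;
  \<open>error_bound\<close> majorizes their means, and its weighted sum is controlled by
  \<open>sum_eta_error_bound\<close>.\<close>

lemma expected_gradient_sum:
  assumes low: "\<And>x. f x \<ge> flow"
  shows "(\<integral>\<^sup>+ \<omega>. ennreal (\<Sum>k<K. eta_p p k * norm (g (fst (st k \<omega>)))) \<partial>M)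
    \<le> ennreal (f x0 - flow + real p * \<sigma>\<^sup>2 +
        (L / 2 + 3 / 2 + 2 * (real p ^ (2 * p) * Lp\<^sup>2) + 2 * ((fact p)\<^sup>2 * \<sigma>\<^sup>2)) * (\<Sum>k<K. 1 / (real k + real p)))"
proof -
  define h where "h = (\<Sum>k<K. 1 / (real k + real p))"
  define a where "a = f x0 - flow + (L / 2 + 3 / 2) * h"
  define c where "c = (\<lambda>k. 2 / 3 * (lyap_weight p k * theta_sum k))"
  have h: "h \<ge> 0" by (simp add: h_def sum_nonneg)
  \<comment> \<open>Nonnegativity of \<open>a\<close> and of the coefficients lets
    \<open>ennreal\<close> distribute over the sums and products that follow.\<close>
  have a: "a \<ge> 0" using low[of x0] h L by (simp add: a_def)
  have c: "c k \<ge> 0" for k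
    using theta_sum_pos[of k] lyap_weight_pos[OF p, of k] by (simp add: c_def)
  define V where "V = (\<lambda>k \<omega>. (momentum_error g (st (Suc k) \<omega>))\<^sup>2)"
  have V [measurable]: "V k \<in> borel_measurable M" for k unfolding V_def by measurable
  have V0: "V k \<omega> \<ge> 0" for k \<omega> by (simp add: V_def)
  have "(\<integral>\<^sup>+ \<omega>. ennreal (\<Sum>k<K. eta_p p k * norm (g (fst (st k \<omega>)))) \<partial>M)
      \<le> (\<integral>\<^sup>+ \<omega>. ennreal (a + (\<Sum>k<K. c k * V k \<omega>)) \<partial>M)"
    using sum_gradient_pathwise[OF low] by (intro nn_integral_mono ennreal_leI) (simp only: a_def h_def c_def V_def mult.assoc)
  also have "\<dots> = (\<integral>\<^sup>+ \<omega>. ennreal a + (\<Sum>k<K. ennreal (c k) * ennreal (V k \<omega>)) \<partial>M)"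
    using a c V0 by (simp add: ennreal_plus sum_nonneg sum_ennreal[symmetric] ennreal_mult del: sum_ennreal)
  also have "\<dots> = ennreal a + (\<Sum>k<K. ennreal (c k) * (\<integral>\<^sup>+ \<omega>. ennreal (V k \<omega>) \<partial>M))"
    by (simp add: nn_integral_add nn_integral_sum nn_integral_cmult M.emeasure_space_1)
  also have "\<dots> \<le> ennreal a + (\<Sum>k<K. ennreal (c k) * ennreal (error_bound k))"
    unfolding V_def by (intro add_left_mono sum_mono mult_left_mono expected_error_le) auto
  also have "\<dots> = ennreal (a + (\<Sum>k<K. c k * error_bound k))"
    using a c error_bound_nonneg by (simp add: ennreal_plus sum_nonneg sum_ennreal[symmetric] ennreal_mult del: sum_ennreal)
  also have "\<dots> \<le> ennreal (a + (real p * \<sigma>\<^sup>2 + (2 * (real p ^ (2 * p) * Lp\<^sup>2) + 2 * ((fact p)\<^sup>2 * \<sigma>\<^sup>2)) * h))"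
    using sum_eta_error_bound[of K] by (intro ennreal_leI add_left_mono) (simp only: c_def h_def mult.assoc)
  also have "a + (real p * \<sigma>\<^sup>2 + (2 * (real p ^ (2 * p) * Lp\<^sup>2) + 2 * ((fact p)\<^sup>2 * \<sigma>\<^sup>2)) * h)
      = f x0 - flow + real p * \<sigma>\<^sup>2 + (L / 2 + 3 / 2 + 2 * (real p ^ (2 * p) * Lp\<^sup>2) + 2 * ((fact p)\<^sup>2 * \<sigma>\<^sup>2)) * h"
    by (simp add: a_def algebra_simps)
  finally show ?thesis by (simp add: h_def)
qed

end

end

section \<open>The convergence rate\<close>

text \<open>\<open>K \<ge> p\<close> gives \<open>K - 1 + p \<le> 2 * K\<close>, and
  \<open>2 powr b \<le> 2\<close> because \<open>b \<le> 1\<close>; the remaining exponent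
  \<open>1 - b\<close> is the rate.\<close>

lemma inverse_step_size_le:
  assumes p: "p \<ge> 2" and K: "K \<ge> p"
  shows "1 / (real K * eta_p p (K - 1)) \<le> 2 / real K powr (real p / (3 * real p + 1))"
proof -
  define b where "b = (2 * real p + 1) / (3 * real p + 1)"
  have b: "0 \<le> b" "b \<le> 1" using p by (auto simp: b_def)
  have e: "real p / (3 * real p + 1) = 1 - b" using p by (simp add: b_def field_simps)
  have "(real (K - 1) + real p) powr b \<le> (2 * real K) powr b"
    using K p b by (intro powr_mono2) auto
  also have "\<dots> = 2 powr b * real K powr b" by (simp add: powr_mult)
  also have "\<dots> \<le> 2 powr 1 * real K powr b" using b by (intro mult_right_mono powr_mono) auto
  finally have "(real (K - 1) + real p) powr b / real K \<le> 2 * real K powr b / real K"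
    by (intro divide_right_mono) auto
  also have "\<dots> = 2 / real K powr (1 - b)" using K p by (simp add: powr_diff)
  finally show ?thesis unfolding e by (simp add: eta_p_def b_def)
qed

lemma eta_p_antimono:
  assumes "p \<ge> 1" "k \<le> j"
  shows "eta_p p j \<le> eta_p p k"
  unfolding eta_p_def using assms by (intro divide_left_mono powr_mono2 mult_pos_pos) auto

lemma one_le_ln_nat:
  assumes "K \<ge> 3"
  shows "1 \<le> ln (real K)"
proof -
  have "exp 1 \<le> real K" using exp_le assms by linarith
  then show ?thesis using assms by (subst ln_ge_iff) auto
qed

theorem theorem3p8:
  fixes f :: "'a::euclidean_space \<Rightarrow> real"
    and gradf :: "'a \<Rightarrow> 'a"
    and G :: "'a \<Rightarrow> 'b \<Rightarrow> 'a"
    and P :: "'b measure"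
    and M :: "'c measure"
    and xis :: "nat \<Rightarrow> 'c \<Rightarrow> 'b"
    and D :: "nat \<Rightarrow> 'a \<Rightarrow> 'a list \<Rightarrow> real"
    and x0 :: 'a and flow L1 sig Lp :: real and p :: nat
  assumes grad: "\<And>x. (f has_derivative (\<lambda>h. gradf x \<bullet> h)) (at x)"
    and A_low: "\<And>x. f x \<ge> flow"
    and A_L1: "L1 > 0" "\<And>x y. norm (gradf y - gradf x) \<le> L1 * norm (y - x)"
    and P_prob: "prob_space P"
    and G_meas: "(\<lambda>(x, e). G x e) \<in> borel_measurable (borel \<Otimes>\<^sub>M P)"
    and A_unbiased: "\<And>x. has_bochner_integral P (G x) (gradf x)"
    and A_var: "sig > 0" "\<And>x. (\<integral>\<^sup>+ e. ennreal ((norm (G x e - gradf x))\<^sup>2) \<partial>P) \<le> ennreal (sig\<^sup>2)"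
    and B_p: "p \<ge> 2"
    and B_diff: "has_derivs_upto p f D"
    and B_Lip: "Lp > 0" "\<And>x y. multilin_norm p (\<lambda>hs. D p y hs - D p x hs) \<le> Lp * norm (y - x)"
    and M_prob: "prob_space M"
    and xis_meas: "\<And>k. xis k \<in> measurable M P"
    and xis_indep: "prob_space.indep_vars M (\<lambda>_. P) xis UNIV"
    and xis_distr: "\<And>k. distr M P (xis k) = P"
    and m_nonzero: "AE \<omega> in M. \<forall>k. sfom_m G x0 (eta_p p) (p - 1) (gamma_p p) (theta_p p) (\<lambda>k. xis k \<omega>) k \<noteq> 0"
  shows "\<forall>\<epsilon>::real. 0 < \<epsilon> \<and> \<epsilon> < 1 \<longrightarrow>
           (\<forall>K::nat. K \<ge> 1 \<and>
              real K \<ge> max (((6 * real p + 2) * M_const p (f x0) flow sig L1 Lp / (real p * \<epsilon>)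
                              * ln ((6 * real p + 2) * M_const p (f x0) flow sig L1 Lp / (real p * \<epsilon>)))
                              powr ((3 * real p + 1) / real p))
                             (2 * real p)
            \<longrightarrow> (\<integral>\<^sup>+ (\<omega>, i). ennreal (norm (gradf
                   (sfom_x G x0 (eta_p p) (p - 1) (gamma_p p) (theta_p p) (\<lambda>k. xis k \<omega>) i)))
                 \<partial>(M \<Otimes>\<^sub>M measure_pmf (pmf_of_set {..<K}))) \<le> ennreal \<epsilon>)"
  proof (intro allI impI, elim conjE)
  fix \<epsilon> :: real and K :: nat
  assume \<epsilon>: "0 < \<epsilon>" "\<epsilon> < 1" and K1: "K \<ge> 1"
    and Kmax: "real K \<ge> max (((6 * real p + 2) * M_const p (f x0) flow sig L1 Lp / (real p * \<epsilon>)
                  * ln ((6 * real p + 2) * M_const p (f x0) flow sig L1 Lp / (real p * \<epsilon>)))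
                  powr ((3 * real p + 1) / real p)) (2 * real p)"
  interpret P: prob_space P by (rule P_prob)
  interpret M: prob_space M by (rule M_prob)
  interpret smooth_oracle P f gradf G D L1 sig Lp p
    by unfold_locales (use assms in auto)
  define s where "s = (\<lambda>k \<omega>. sfom_state G x0 (eta_p p) (p-1) (gamma_p p) (theta_p p) (\<lambda>k. xis k \<omega>) k)"
  define X where "X = (\<lambda>k \<omega>. norm (gradf (fst (s k \<omega>))))"
  define h where "h = (\<Sum>k<K. 1 / (real k + real p))"
  define C where "C = L1 / 2 + 3 / 2 + 2 * (real p ^ (2 * p) * Lp\<^sup>2) + 2 * ((fact p)\<^sup>2 * sig\<^sup>2)"
  define F where "F = f x0 - flow + real p * sig\<^sup>2"
  define T where "T = F + C * h"
  \<comment> \<open>\<open>eta_p p (K - 1)\<close> is the smallest of the first \<open>K\<close>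
    step sizes, so \<open>c\<close> times the step-weighted sum dominates the uniform
    average.\<close>
  define c where "c = 1 / (real K * eta_p p (K - 1))"
  define Mp where "Mp = M_const p (f x0) flow sig L1 Lp"
  have Kp: "real K \<ge> 2 * real p" using Kmax by simp
  then have K4: "K \<ge> 4" using B_p by linarith
  have eta_pos: "eta_p p k > 0" for k using B_p by (simp add: eta_p_def)
  have c: "c > 0" using K1 eta_pos by (simp add: c_def)
  have C: "C \<ge> 0" using A_L1(1) by (simp add: C_def)
  have lnK: "1 \<le> ln (real K)" using K4 by (intro one_le_ln_nat) auto

  have grad_sum: "(\<integral>\<^sup>+ \<omega>. ennreal (\<Sum>k<K. eta_p p k * X k \<omega>) \<partial>M) \<le> ennreal T"
    using expected_gradient_sum[OF M_prob xis_meas xis_indep xis_distr A_low]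
    by (simp only: X_def s_def T_def F_def C_def h_def)

  \<comment> \<open>\<open>M_const\<close> dominates \<open>4 * (F + C)\<close> term by term, with
    \<open>3 / 2\<close> covered by \<open>2 * (p + 1)\<close>. One factor 2 of the 4 pays for
    \<open>h \<le> 2 * ln K\<close>, the other for the 2 in
    \<open>inverse_step_size_le\<close>.\<close>
  have Mp: "2 * (F + C) \<le> Mp / 2"
  proof -
    have "7 * Lp\<^sup>2 / (fact p)\<^sup>2 \<ge> 0" "real p ^ (2 * p) * Lp\<^sup>2 \<ge> 0" "(fact p)\<^sup>2 * sig\<^sup>2 \<ge> 0" by auto
    then show ?thesis using A_L1(1) B_p unfolding Mp_def M_const_def C_def F_def mult.assoc by simp
  qed
  have base: "F \<ge> 0" using A_low[of x0] by (simp add: F_def)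
  have "3 / 2 \<le> F + C" using base A_L1(1) by (simp add: C_def)
  then have Mp1: "Mp \<ge> 1" using Mp by simp
  have "h \<le> 2 * ln (real K)" unfolding h_def using B_p K4 by (intro sum_inverse_shift_le) auto
  then have "T \<le> F * 1 + C * (2 * ln (real K))"
    unfolding T_def using C by (intro add_mono mult_left_mono) auto
  \<comment> \<open>\<open>ln K \<ge> 1\<close> lets the constant part be charged to the logarithm
    as well.\<close>
  also have "\<dots> \<le> F * (2 * ln (real K)) + C * (2 * ln (real K))"
    using base lnK by (intro add_right_mono mult_left_mono) auto
  also have "\<dots> = (2 * (F + C)) * ln (real K)" by (simp add: algebra_simps)
  also have "\<dots> \<le> Mp / 2 * ln (real K)" using Mp lnK by (intro mult_right_mono) auto
  finally have T: "T \<le> Mp / 2 * ln (real K)" .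
  have "c \<le> 2 / real K powr (real p / (3 * real p + 1))"
    unfolding c_def using B_p Kp by (intro inverse_step_size_le) auto
  then have "c * T \<le> 2 / real K powr (real p / (3 * real p + 1)) * (Mp / 2 * ln (real K))"
    using T c Mp1 lnK by (intro order_trans[OF mult_left_mono[OF T] mult_right_mono]) auto
  also have "\<dots> = Mp * ln (real K) / real K powr (real p / (3 * real p + 1))" by simp
  also have "\<dots> \<le> \<epsilon>"
    using Kmax by (intro rate_le_epsilon[OF B_p Mp1 \<epsilon> K1]) (simp add: Mp_def)
  finally have cT: "c * T \<le> \<epsilon>" .

  have "s k \<in> borel_measurable M" for k
    unfolding s_def by (rule sfom_state_measurable[OF G_meas xis_meas])
  then have X [measurable]: "X k \<in> borel_measurable M" for k
    unfolding X_def
    by (rule measurable_compose[OF _ borel_measurable_continuous_onI])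
       (intro continuous_intros continuous_on_compose2[OF continuous_gradient], auto)
  \<comment> \<open>The index lives in a countable discrete space, so measurability for each fixed
    index suffices.\<close>
  have meas: "(\<lambda>(\<omega>, i). ennreal (X i \<omega>)) \<in> borel_measurable (M \<Otimes>\<^sub>M measure_pmf (pmf_of_set {..<K}))"
    unfolding case_prod_beta
    by (rule measurable_compose_countable'[where f = "\<lambda>i z. ennreal (X i (fst z))" and g = snd and I = UNIV])
       auto
  have avg: "(\<integral>\<^sup>+ i. ennreal (X i \<omega>) \<partial>measure_pmf (pmf_of_set {..<K})) \<le> ennreal (c * (\<Sum>k<K. eta_p p k * X k \<omega>))" for \<omega>
  proof -
    have "(\<integral>\<^sup>+ i. ennreal (X i \<omega>) \<partial>measure_pmf (pmf_of_set {..<K})) = (\<Sum>i<K. ennreal (X i \<omega>)) / real K"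
      using K1 by (subst nn_integral_pmf_of_set) (auto simp: lessThan_empty_iff ennreal_of_nat_eq_real_of_nat)
    also have "\<dots> = ennreal ((\<Sum>i<K. X i \<omega>) / real K)"
      using K1 by (subst sum_ennreal) (auto simp: X_def divide_ennreal sum_nonneg)
    also have "\<dots> \<le> ennreal (c * (\<Sum>k<K. eta_p p k * X k \<omega>))"
    proof (rule ennreal_leI)
      have "eta_p p (K - 1) * (\<Sum>i<K. X i \<omega>) \<le> (\<Sum>k<K. eta_p p k * X k \<omega>)"
        unfolding sum_distrib_left using B_p
        by (intro sum_mono mult_right_mono eta_p_antimono) (auto simp: X_def)
      from mult_left_mono[OF this, of c] show "(\<Sum>i<K. X i \<omega>) / real K \<le> c * (\<Sum>k<K. eta_p p k * X k \<omega>)"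
        using c eta_pos[of "K - 1"] by (simp add: c_def)
    qed
    finally show ?thesis .
  qed
  \<comment> \<open>Tonelli on the product measure, which encodes the independence of the random
    index from the algorithm.\<close>
  have "(\<integral>\<^sup>+ (\<omega>, i). ennreal (X i \<omega>) \<partial>(M \<Otimes>\<^sub>M measure_pmf (pmf_of_set {..<K})))
      = (\<integral>\<^sup>+ \<omega>. (\<integral>\<^sup>+ i. ennreal (X i \<omega>) \<partial>measure_pmf (pmf_of_set {..<K})) \<partial>M)"
    using measure_pmf.nn_integral_fst[OF meas] by simp
  also have "\<dots> \<le> (\<integral>\<^sup>+ \<omega>. ennreal c * ennreal (\<Sum>k<K. eta_p p k * X k \<omega>) \<partial>M)"
    using avg c by (intro nn_integral_mono) (simp add: ennreal_mult' less_imp_le)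
  also have "\<dots> = ennreal c * (\<integral>\<^sup>+ \<omega>. ennreal (\<Sum>k<K. eta_p p k * X k \<omega>) \<partial>M)"
    by (intro nn_integral_cmult) measurable
  also have "\<dots> \<le> ennreal c * ennreal T" by (intro mult_left_mono grad_sum) simp
  also have "\<dots> = ennreal (c * T)" using c by (simp add: ennreal_mult' less_imp_le)
  also have "\<dots> \<le> ennreal \<epsilon>" using cT by (rule ennreal_leI)
  finally show "(\<integral>\<^sup>+ (\<omega>, i). ennreal (norm (gradf
        (sfom_x G x0 (eta_p p) (p - 1) (gamma_p p) (theta_p p) (\<lambda>k. xis k \<omega>) i)))
        \<partial>(M \<Otimes>\<^sub>M measure_pmf (pmf_of_set {..<K}))) \<le> ennreal \<epsilon>"
    by (simp only: X_def s_def sfom_x_def)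
qed

end
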